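(* Consider the fully discrete nonuniform L2-$1_\sigma$ scheme (defined in the context) for the time-fractional Allen–Cahn model with $\alpha\in(0,1)$, $\epsilon>0$, mesh size $h$, and initial data with $\|\phi^0\|_\infty\le 1$. Assume $r_k\ge r_\star(\alpha)$ for all $k\ge2$, where $r_\star(\alpha)$ is the unique positive root $r$ of $$2\sqrt{\frac{2(1-\alpha/2)r}{1+\alpha+(1-\alpha/2)r}+\frac{r}{1+r}}+3-\frac{1}{r^2(1+r)}=0,$$ and, for all $1\le n\le N$, $$\tau_n\le\min\Big\{\Big(\frac{\theta\,\omega_{2-\alpha}(1-\theta)}{2(1-\theta)}\Big)^{1/\alpha},\ \Big(\frac{h^2\,\omega_{2-\alpha}(1-\theta)}{4\epsilon^2}\Big)^{1/\alpha}\Big\},\qquad\theta=\alpha/2.$$ Then the solution satisfies the discrete energy dissipation law $$\frac{\mathcal E_\alpha[\phi^n]-\mathcal E_\alpha[\phi^{n-1}]}{\tau_n}+\frac{\alpha}{2(2-\alpha)}a^{(n)}_0\,\tau_n\Big\|\frac{\phi^n-\phi^{n-1}}{\tau_n}\Big\|^2\le0\qquad\text{for }1\le n\le N.$$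
   Context: Time mesh $0=t_0<\cdots<t_N=T$, $\tau_k=t_k-t_{k-1}$, $r_k=\tau_k/\tau_{k-1}$; $\omega_\beta(t)=t^{\beta-1}/\Gamma(\beta)$; $t_{n-\theta}=\theta t_{n-1}+(1-\theta)t_n$; $\varpi_n'(t)=\omega_{1-\alpha}(t_{n-\theta}-t)$; $\nabla_\tau v^k=v^k-v^{k-1}$. For $1\le k\le n$: $a^{(n)}_{n-k}=\frac{1}{\tau_k}\int_{t_{k-1}}^{\min\{t_k,t_{n-\theta}\}}\varpi_n'(s)ds$, $\zeta^{(n)}_{n-k}=\frac{2}{\tau_k^2}\int_{t_{k-1}}^{t_k}(s-\frac{t_{k-1}+t_k}{2})\varpi_n'(s)ds$. L2-$1_\sigma$ formula: $(\partial^\alpha_\tau v)^{n-\theta}=a^{(n)}_0\nabla_\tau v^n+\sum_{k=1}^{n-1}\big(a^{(n)}_{n-k}\nabla_\tau v^k+\frac{\nabla_\tau v^{k+1}-r_{k+1}\nabla_\tau v^k}{r_{k+1}(1+r_{k+1})}\zeta^{(n)}_{n-k}\big)$. Kernels: $\hat a^{(1)}_0=\frac{2(1-\alpha)}{2-\alpha}a^{(1)}_0$; for $n\ge2$: $\hat a^{(n)}_0=\frac{2(1-\alpha)}{2-\alpha}a^{(n)}_0+\frac{\zeta^{(n)}_1}{r_n(1+r_n)}$, $\hat a^{(n)}_{n-k}=a^{(n)}_{n-k}+\frac{\zeta^{(n)}_{n-k+1}}{r_k(1+r_k)}-\frac{\zeta^{(n)}_{n-k}}{1+r_{k+1}}$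 ($2\le k\le n-1$), $\hat a^{(n)}_{n-1}=a^{(n)}_{n-1}-\frac{\zeta^{(n)}_{n-1}}{1+r_2}$; $A^{(n)}_0=2\hat a^{(n)}_0$, $A^{(n)}_{n-k}=\hat a^{(n)}_{n-k}$ ($1\le k\le n-1$). For $m\ge1$ and a sequence $w=(w^1,w^2,\dots)$: $\mathcal G_m[w]=\sum_{j=1}^{m-1}(A^{(m)}_{m-j-1}-A^{(m)}_{m-j})(\sum_{\ell=j+1}^m w^\ell)^2+A^{(m)}_{m-1}(\sum_{\ell=1}^m w^\ell)^2$, and $\mathcal G_0:=0$. Space: $\Omega=(0,L)^2$, $h=L/M$, grid $\{(ih,jh)\}$, $\Delta_h$ the standard five-point discrete Laplacian with periodic boundary conditions, $\nabla_h$ the corresponding discrete gradient (so that $\langle-\Delta_h u,v\rangle=\langle\nabla_h u,\nabla_h v\rangle$), $\langle u,v\rangle=h^2\sum u v$ the discrete inner product over grid points, $\|\cdot\|$ the discrete $L^2$ norm, $\|\cdot\|_\infty$ the grid maximum norm. Scheme, with $f(\phi)=\phi^3-\phi$: $(\partial^\alpha_\tau\phi)^{n-\theta}=-\big[\theta f(\phi^{n-1})+(1-\theta)f(\phi^n)-\epsilon^2\Delta_h(\theta\phi^{n-1}+(1-\theta)\phi^n)\big]$ for $n\ge1$, applied pointwise. Energies: $E[\phi^n]=\frac{\epsilon^2}{2}\|\nabla_h\phi^n\|^2+\langle F(\phi^n),1\rangle$ with $F(\phi)=\frac14(\phi^2-1)^2$, and the modified energy $\mathcal E_\alpha[\phi^n]=E[\phi^n]+\frac12\langle\mathcal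 G_n[\nabla_\tau\phi],1\rangle$ (pointwise in space, $\nabla_\tau\phi=(\nabla_\tau\phi^1,\nabla_\tau\phi^2,\dots)$), so $\mathcal E_\alpha[\phi^0]=E[\phi^0]$. *)

theory Defs
  imports "HOL-Analysis.Analysis"
begin

definition tau :: "(nat \<Rightarrow> real) \<Rightarrow> nat \<Rightarrow> real" where
  "tau t k = t k - t (k - 1)"

definition rr :: "(nat \<Rightarrow> real) \<Rightarrow> nat \<Rightarrow> real" where
  "rr t k = tau t k / tau t (k - 1)"

definition omega :: "real \<Rightarrow> real \<Rightarrow> real" where
  "omega \<beta> x = x powr (\<beta> - 1) / Gamma \<beta>"

definition tth :: "(nat \<Rightarrow> real) \<Rightarrow> real \<Rightarrow> nat \<Rightarrow> real" where
  "tth t \<theta> n = \<theta> * t (n - 1) + (1 - \<theta>) * t n"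

definition varpi' :: "real \<Rightarrow> real \<Rightarrow> (nat \<Rightarrow> real) \<Rightarrow> nat \<Rightarrow> real \<Rightarrow> real" where
  "varpi' \<alpha> \<theta> t n s = omega (1 - \<alpha>) (tth t \<theta> n - s)"

definition akern :: "real \<Rightarrow> real \<Rightarrow> (nat \<Rightarrow> real) \<Rightarrow> nat \<Rightarrow> nat \<Rightarrow> real" where
  "akern \<alpha> \<theta> t n j = (let k = n - j in
     (1 / tau t k) * integral {t (k - 1) .. min (t k) (tth t \<theta> n)} (varpi' \<alpha> \<theta> t n))"

definition zeta :: "real \<Rightarrow> real \<Rightarrow> (nat \<Rightarrow> real) \<Rightarrow> nat \<Rightarrow> nat \<Rightarrow> real" where
  "zeta \<alpha> \<theta> t n j = (let k = n - j in
     (2 / (tau t k)^2) * integral {t (k - 1) .. t k}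
        (\<lambda>s. (s - (t (k - 1) + t k) / 2) * varpi' \<alpha> \<theta> t n s))"

text \<open>L2-1_sigma approximation of the Caputo derivative at t_{n-theta}, for a scalar sequence v\<close>
definition L21sigma :: "real \<Rightarrow> real \<Rightarrow> (nat \<Rightarrow> real) \<Rightarrow> (nat \<Rightarrow> real) \<Rightarrow> nat \<Rightarrow> real" where
  "L21sigma \<alpha> \<theta> t v n =
     akern \<alpha> \<theta> t n 0 * (v n - v (n - 1))
     + (\<Sum>k = 1..n - 1. akern \<alpha> \<theta> t n (n - k) * (v k - v (k - 1))
         + ((v (k + 1) - v k) - rr t (k + 1) * (v k - v (k - 1)))
           / (rr t (k + 1) * (1 + rr t (k + 1))) * zeta \<alpha> \<theta> t n (n - k))"

definition ahat :: "real \<Rightarrow> real \<Rightarrow> (nat \<Rightarrow> real) \<Rightarrow> nat \<Rightarrow> nat \<Rightarrow> real" where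
  "ahat \<alpha> \<theta> t n j =
    (if j = 0 then
       (if n = 1 then 2 * (1 - \<alpha>) / (2 - \<alpha>) * akern \<alpha> \<theta> t 1 0
        else 2 * (1 - \<alpha>) / (2 - \<alpha>) * akern \<alpha> \<theta> t n 0
             + zeta \<alpha> \<theta> t n 1 / (rr t n * (1 + rr t n)))
     else if j = n - 1 then
       akern \<alpha> \<theta> t n (n - 1) - zeta \<alpha> \<theta> t n (n - 1) / (1 + rr t 2)
     else (let k = n - j in
       akern \<alpha> \<theta> t n j + zeta \<alpha> \<theta> t n (j + 1) / (rr t k * (1 + rr t k))
         - zeta \<alpha> \<theta> t n j / (1 + rr t (k + 1))))"

definition Akern :: "real \<Rightarrow> real \<Rightarrow> (nat \<Rightarrow> real) \<Rightarrow> nat \<Rightarrow> nat \<Rightarrow> real" where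
  "Akern \<alpha> \<theta> t n j = (if j = 0 then 2 * ahat \<alpha> \<theta> t n 0 else ahat \<alpha> \<theta> t n j)"

definition Gfun :: "real \<Rightarrow> real \<Rightarrow> (nat \<Rightarrow> real) \<Rightarrow> nat \<Rightarrow> (nat \<Rightarrow> real) \<Rightarrow> real" where
  "Gfun \<alpha> \<theta> t m w =
    (if m = 0 then 0 else
      (\<Sum>j = 1..m - 1. (Akern \<alpha> \<theta> t m (m - j - 1) - Akern \<alpha> \<theta> t m (m - j))
                          * (\<Sum>l = j + 1..m. w l)^2)
      + Akern \<alpha> \<theta> t m (m - 1) * (\<Sum>l = 1..m. w l)^2)"

section \<open>Periodic grid on (0,L)^2 with M x M points (i h, j h), 0 <= i,j < M\<close>

type_synonym grid_fun = "nat \<times> nat \<Rightarrow> real"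

definition lap_h :: "nat \<Rightarrow> real \<Rightarrow> grid_fun \<Rightarrow> grid_fun" where
  "lap_h M h u = (\<lambda>(i, j).
     (u ((i + 1) mod M, j) + u ((i + M - 1) mod M, j)
      + u (i, (j + 1) mod M) + u (i, (j + M - 1) mod M) - 4 * u (i, j)) / h^2)"

definition ip_h :: "nat \<Rightarrow> real \<Rightarrow> grid_fun \<Rightarrow> grid_fun \<Rightarrow> real" where
  "ip_h M h u v = h^2 * (\<Sum>i<M. \<Sum>j<M. u (i, j) * v (i, j))"

text \<open>||grad_h u||^2 with the forward-difference periodic gradient
  (so that <-lap_h u, v> = <grad_h u, grad_h v>)\<close>
definition gradnorm2_h :: "nat \<Rightarrow> real \<Rightarrow> grid_fun \<Rightarrow> real" where
  "gradnorm2_h M h u = h^2 * (\<Sum>i<M. \<Sum>j<M.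
      ((u ((i + 1) mod M, j) - u (i, j)) / h)^2 + ((u (i, (j + 1) mod M) - u (i, j)) / h)^2)"

definition fAC :: "real \<Rightarrow> real" where "fAC x = x^3 - x"
definition FAC :: "real \<Rightarrow> real" where "FAC x = (x^2 - 1)^2 / 4"

definition energy :: "nat \<Rightarrow> real \<Rightarrow> real \<Rightarrow> grid_fun \<Rightarrow> real" where
  "energy M h \<epsilon> u = \<epsilon>^2 / 2 * gradnorm2_h M h u + ip_h M h (\<lambda>x. FAC (u x)) (\<lambda>_. 1)"

definition mod_energy :: "real \<Rightarrow> real \<Rightarrow> (nat \<Rightarrow> real) \<Rightarrow> nat \<Rightarrow> real \<Rightarrow> real
     \<Rightarrow> (nat \<Rightarrow> grid_fun) \<Rightarrow> nat \<Rightarrow> real" where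
  "mod_energy \<alpha> \<theta> t M h \<epsilon> \<phi> n =
     energy M h \<epsilon> (\<phi> n)
     + 1/2 * ip_h M h (\<lambda>x. Gfun \<alpha> \<theta> t n (\<lambda>l. \<phi> l x - \<phi> (l - 1) x)) (\<lambda>_. 1)"

definition r_star :: "real \<Rightarrow> real" where
  "r_star \<alpha> = (THE r. r > 0 \<and>
     2 * sqrt (2 * (1 - \<alpha>/2) * r / (1 + \<alpha> + (1 - \<alpha>/2) * r) + r / (1 + r))
       + 3 - 1 / (r^2 * (1 + r)) = 0)"

end

theory Submission
  imports Defs
begin

text \<open>
  Write \<open>\<theta> = \<alpha>/2\<close>, \<open>\<sigma> = 1 - \<theta>\<close>, and \<open>g\<^sub>n(s) = \<omega>\<^bsub>1-\<alpha>\<^esub>(t\<^bsub>n-\<theta>\<^esub> - s)\<close>. Because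
  \<open>2(1-\<alpha>)/(2-\<alpha>) a\<^sub>0 = g\<^sub>n(t\<^bsub>n-1\<^esub>)\<close>, all increments of the kernels \<open>\<hat>a\<close> are combinations of means and
  first moments of \<open>g\<^sub>n\<close> over single mesh intervals, and comparing \<open>g\<^sub>n\<close> (or \<open>g\<^bsub>n-1\<^esub> - g\<^sub>n\<close>, which is convex
  and increasing as well) with a tangent line bounds them from below. Of the ratio condition only
  \<open>r\<^sub>k \<ge> 77/200\<close> is used. This yields the discrete gradient inequality
  \<open>w\<^sup>n \<Sum>\<^sub>k A\<^bsub>n-k\<^esub> w\<^sup>k - \<hat>a\<^sub>0 (w\<^sup>n)\<^sup>2 \<ge> (G\<^sub>n - G\<^bsub>n-1\<^esub>)/2\<close>.

  The kernels do not satisfy \<open>\<hat>a\<^sub>0 \<ge> \<hat>a\<^sub>1\<close> (a step ratio near \<open>r\<^sub>\<star>\<close> followed by a large one violates it),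
  so the usual argument for \<open>\<bar>\<phi>\<bar> \<le> 1\<close> is not available. Only \<open>\<hat>a\<^sub>0 \<ge> \<hat>a\<^sub>1 - (\<theta>/4) g\<^sub>n(t\<^bsub>n-1\<^esub>)\<close> holds, and
  the invariant is \<open>\<bar>\<phi>\<bar> \<le> B\<close> with \<open>3\<theta>B\<^sup>2 = Q - 1 + 2\<theta>\<close>, \<open>Q = max 2 (4\<epsilon>\<^sup>2\<theta>/(\<sigma>h\<^sup>2))\<close>: this is the
  largest \<open>B\<close> for which the convexity defect of the double well on \<open>[-B, B]\<close> is still absorbed by half of
  the term \<open>(\<theta>/\<sigma>) a\<^sub>0 (w\<^sup>n)\<^sup>2\<close> under the step restriction.
\<close>

subsection \<open>Mean and first moment of a function on an interval\<close>

text \<open>The integrals of \<open>akern\<close> and \<open>zeta\<close> over a full mesh interval,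
  abstracted to an arbitrary integrand so that one set of bounds serves a single kernel and a
  difference of two kernels.\<close>

definition mean :: "(real \<Rightarrow> real) \<Rightarrow> real \<Rightarrow> real \<Rightarrow> real" where
  "mean g a b = 1 / (b - a) * integral {a..b} g"

definition moment :: "(real \<Rightarrow> real) \<Rightarrow> real \<Rightarrow> real \<Rightarrow> real" where
  "moment g a b = 2 / (b - a)^2 * integral {a..b} (\<lambda>s. (s - (a + b) / 2) * g s)"

lemma moment_integrable:
  fixes g :: "real \<Rightarrow> real"
  assumes "continuous_on {a..b} g"
  shows "(\<lambda>s. (s - (a + b) / 2) * g s) integrable_on {a..b}"
  by (intro integrable_continuous_real continuous_intros assms)

lemma mean_diff:
  assumes "continuous_on {a..b} f" "continuous_on {a..b} g"
  shows "mean (\<lambda>s. f s - g s) a b = mean f a b - mean g a b"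
  using assms by (simp add: mean_def integral_diff integrable_continuous_real right_diff_distrib diff_divide_distrib)

lemma moment_diff:
  assumes "continuous_on {a..b} f" "continuous_on {a..b} g"
  shows "moment (\<lambda>s. f s - g s) a b = moment f a b - moment g a b"
  using integral_diff[OF moment_integrable[OF assms(1)] moment_integrable[OF assms(2)]]
  by (simp add: moment_def right_diff_distrib)

lemma mean_affine:
  assumes "a < b"
  shows "mean (\<lambda>s. d + c * (s - a)) a b = d + c * (b - a) / 2"
proof -
  have "((\<lambda>s. d + c * (s - a)) has_integral (d * (b - a) + c * (b - a)^2 / 2) - (d * (a - a) + c * (a - a)^2 / 2)) {a..b}"
    using assms by (intro fundamental_theorem_of_calculus)
      (auto intro!: derivative_eq_intros simp: has_real_derivative_iff_has_vector_derivative[symmetric])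
  then show ?thesis using assms by (simp add: mean_def integral_unique field_simps power2_eq_square)
qed

lemma moment_affine:
  assumes "a < b"
  shows "moment (\<lambda>s. d + c * (s - a)) a b = c * (b - a) / 6"
proof -
  define F where "F s = d * (s - a)^2 / 2 - d * (b - a) / 2 * (s - a) + c * (s - a)^3 / 3 - c * (b - a) * (s - a)^2 / 4"
    for s
  have "((\<lambda>s. (s - (a + b) / 2) * (d + c * (s - a))) has_integral F b - F a) {a..b}"
    using assms unfolding F_def by (intro fundamental_theorem_of_calculus)
      (auto intro!: derivative_eq_intros simp: has_real_derivative_iff_has_vector_derivative[symmetric] field_simps power2_eq_square)
  moreover have "F b - F a = c * (b - a)^3 / 12"
    unfolding F_def by (simp add: power2_eq_square power3_eq_cube field_simps)
  ultimately show ?thesis using assms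
    by (simp add: moment_def integral_unique) (simp add: power2_eq_square power3_eq_cube)
qed

lemma mean_mono:
  assumes "a < b" "continuous_on {a..b} f" "continuous_on {a..b} g" "\<And>s. s \<in> {a..b} \<Longrightarrow> f s \<le> g s"
  shows "mean f a b \<le> mean g a b"
  using assms unfolding mean_def
  by (intro mult_left_mono integral_le integrable_continuous_real) auto

text \<open>A constant has zero moment. Subtracting \<open>q ?m\<close> leaves the integrand
  \<open>(s - ?m) * (q s - q ?m)\<close>, whose factors have equal sign.\<close>

lemma moment_nonneg:
  assumes "a < b" "continuous_on {a..b} q" "mono_on {a..b} q"
  shows "0 \<le> moment q a b"
proof -
  let ?m = "(a + b) / 2"
  have i: "(\<lambda>s. (s - ?m) * q s) integrable_on {a..b}" by (rule moment_integrable[OF assms(2)])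
  have j: "(\<lambda>s. (s - ?m) * q ?m) integrable_on {a..b}"
    by (intro integrable_continuous_real continuous_intros)
  have "integral {a..b} (\<lambda>s. (s - ?m) * q ?m) \<le> integral {a..b} (\<lambda>s. (s - ?m) * q s)"
  proof (rule integral_le[OF j i])
    fix s assume s: "s \<in> {a..b}"
    have m: "?m \<in> {a..b}" using assms(1) by auto
    show "(s - ?m) * q ?m \<le> (s - ?m) * q s"
    proof (cases "s \<le> ?m")
      case True
      then have "q s \<le> q ?m" using mono_onD[OF assms(3) s m] by simp
      then show ?thesis using True by (intro mult_left_mono_neg) auto
    next
      case False
      then have "q ?m \<le> q s" using mono_onD[OF assms(3) m s] by simp
      then show ?thesis using False by (intro mult_left_mono) auto
    qed
  qed
  moreover have "moment (\<lambda>s. q ?m + 0 * (s - a)) a b = 0"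
    using moment_affine[OF assms(1), of "q ?m" 0] by simp
  then have "integral {a..b} (\<lambda>s. (s - ?m) * q ?m) = 0"
    using assms(1) by (simp add: moment_def)
  ultimately show ?thesis by (simp only: moment_def) simp
qed

text \<open>The functional is integration against the affine weight \<open>?w\<close>, whose minimum
  \<open>(1 - c) / (b - a)\<close> is attained at \<open>b\<close>. It is applied with
  \<open>c = 1 / (1 + r)\<close>, the share of the moment in \<open>ahat\<close>.\<close>

lemma weighted_mean_mono:
  assumes ab: "a < b" and cf: "continuous_on {a..b} f" and cg: "continuous_on {a..b} g"
    and le: "\<And>s. s \<in> {a..b} \<Longrightarrow> f s \<le> g s" and c: "0 \<le> c" "c \<le> 1"
  shows "mean f a b - c * moment f a b \<le> mean g a b - c * moment g a b"
proof -
  let ?w = "\<lambda>s. 1 / (b - a) - 2 * c / (b - a)^2 * (s - (a + b) / 2)"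
  have eq: "mean h a b - c * moment h a b = integral {a..b} (\<lambda>s. ?w s * h s)"
    if ch: "continuous_on {a..b} h" for h
  proof -
    have "integral {a..b} (\<lambda>s. ?w s * h s) =
      integral {a..b} (\<lambda>s. 1 / (b - a) * h s - 2 * c / (b - a)^2 * ((s - (a + b) / 2) * h s))"
      by (rule arg_cong[where f = "integral {a..b}"]) (auto simp: left_diff_distrib)
    also have "\<dots> = integral {a..b} (\<lambda>s. 1 / (b - a) * h s)
        - integral {a..b} (\<lambda>s. 2 * c / (b - a)^2 * ((s - (a + b) / 2) * h s))"
      by (intro integral_diff integrable_continuous_real continuous_intros ch)
    finally show ?thesis by (simp only: integral_mult_right mean_def moment_def) simp
  qed
  have "integral {a..b} (\<lambda>s. ?w s * f s) \<le> integral {a..b} (\<lambda>s. ?w s * g s)"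
  proof (rule integral_le)
    fix s assume s: "s \<in> {a..b}"
    have "0 \<le> ?w s"
    proof -
      have "c * (2 * s - (a + b)) \<le> 1 * (b - a)"
      proof (cases "2 * s \<le> a + b")
        case True
        then have "c * (2 * s - (a + b)) \<le> 0" using c by (intro mult_nonneg_nonpos) auto
        then show ?thesis using ab by simp
      next
        case False
        then show ?thesis using c s by (intro mult_mono) auto
      qed
      then have "2 * c * (s - (a + b) / 2) / (b - a)^2 \<le> (b - a) / (b - a)^2"
        by (intro divide_right_mono) (auto simp: field_simps)
      then show ?thesis using ab by (simp add: power2_eq_square)
    qed
    then show "?w s * f s \<le> ?w s * g s" using le[OF s] by (rule mult_left_mono[rotated])
  qed (intro integrable_continuous_real continuous_intros cf cg)+
  then show ?thesis using eq[OF cf] eq[OF cg] by simp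
qed

text \<open>The bounds below compare \<open>g\<close> with the affine function of slope \<open>G\<close> through \<open>(a, g a)\<close>.\<close>

lemma deriv_ge_imp_mono_diff:
  fixes g :: "real \<Rightarrow> real"
  assumes "\<And>s. s \<in> {a..b} \<Longrightarrow> (g has_real_derivative g' s) (at s)" "\<And>s. s \<in> {a..b} \<Longrightarrow> G \<le> g' s"
  shows "mono_on {a..b} (\<lambda>s. g s - (g a + G * (s - a)))"
proof (rule mono_onI)
  fix x y assume xy: "x \<in> {a..b}" "y \<in> {a..b}" "x \<le> y"
  show "g x - (g a + G * (x - a)) \<le> g y - (g a + G * (y - a))"
  proof (rule DERIV_nonneg_imp_nondecreasing[OF xy(3)])
    fix s assume "x \<le> s" "s \<le> y"
    then have "s \<in> {a..b}" using xy by auto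
    then show "\<exists>y. ((\<lambda>s. g s - (g a + G * (s - a))) has_real_derivative y) (at s) \<and> 0 \<le> y"
      using assms by (intro exI[of _ "g' s - G"]) (auto intro!: derivative_eq_intros)
  qed
qed

context
  fixes g g' :: "real \<Rightarrow> real" and a b G :: real
  assumes ab: "a < b" and dg: "\<And>s. s \<in> {a..b} \<Longrightarrow> (g has_real_derivative g' s) (at s)"
begin

lemma cont_g: "continuous_on {a..b} g"
  using dg by (intro continuous_at_imp_continuous_on) (blast intro: DERIV_isCont)

lemma cont_tangent: "continuous_on {a..b} (\<lambda>s. g a + G * (s - a))"
  by (intro continuous_intros)

lemma moment_ge:
  assumes "\<And>s. s \<in> {a..b} \<Longrightarrow> G \<le> g' s"
  shows "G * (b - a) / 6 \<le> moment g a b"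
  using moment_nonneg[OF ab continuous_on_diff[OF cont_g cont_tangent] deriv_ge_imp_mono_diff[OF dg assms]]
    moment_diff[OF cont_g cont_tangent] moment_affine[OF ab, of "g a" G] by simp

lemma mean_le_end:
  assumes "\<And>s. s \<in> {a..b} \<Longrightarrow> G \<le> g' s"
  shows "mean g a b \<le> g b - G * (b - a) / 2"
proof -
  let ?q = "\<lambda>s. g s - (g a + G * (s - a))"
  have "mean ?q a b \<le> mean (\<lambda>s. ?q b + 0 * (s - a)) a b"
    using mono_onD[OF deriv_ge_imp_mono_diff[OF dg assms]] ab
    by (intro mean_mono[OF ab continuous_on_diff[OF cont_g cont_tangent]] continuous_intros) auto
  then show ?thesis
    unfolding mean_affine[OF ab] using mean_diff[OF cont_g cont_tangent] mean_affine[OF ab, of "g a" G]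
    by simp
qed

lemma weighted_mean_ge_start:
  assumes G: "\<And>s. s \<in> {a..b} \<Longrightarrow> G \<le> g' s" and c: "0 \<le> c" "c \<le> 1"
  shows "g a + G * (b - a) * (1/2 - c/6) \<le> mean g a b - c * moment g a b"
proof -
  have "g a + G * (s - a) \<le> g s" if "s \<in> {a..b}" for s
    using mono_onD[OF deriv_ge_imp_mono_diff[OF dg G], of a s] that ab by force
  then have "mean (\<lambda>s. g a + G * (s - a)) a b - c * moment (\<lambda>s. g a + G * (s - a)) a b
      \<le> mean g a b - c * moment g a b"
    by (intro weighted_mean_mono[OF ab cont_tangent cont_g _ c])
  then show ?thesis unfolding mean_affine[OF ab] moment_affine[OF ab] by (simp add: algebra_simps diff_divide_distrib)
qed

text \<open>A convex function lies below its chord and the weighted mean is monotone. The weights of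
  the end values come from the mean (1/2) and the moment (1/6) of a line of unit rise.\<close>

lemma weighted_mean_le_chord:
  assumes mono: "\<And>s u. s \<in> {a..b} \<Longrightarrow> u \<in> {a..b} \<Longrightarrow> s \<le> u \<Longrightarrow> g' s \<le> g' u" and c: "0 \<le> c" "c \<le> 1"
  shows "mean g a b - c * moment g a b \<le> (1/2 + c/6) * g a + (1/2 - c/6) * g b"
proof -
  define H where "H = (g b - g a) / (b - a)"
  have cv: "convex_on {a..b} g" by (rule convex_on_realI[where f' = g']) (use dg mono in auto)
  have "g s \<le> g a + H * (s - a)" if s: "s \<in> {a..b}" for s
  proof -
    define u where "u = (s - a) / (b - a)"
    have "u * (b - a) = s - a" using ab by (simp add: u_def)
    then have "(1 - u) * a + u * b = s" by (simp add: algebra_simps)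
    moreover have "0 \<le> u" "u \<le> 1" using s ab by (auto simp: u_def)
    ultimately have u: "0 \<le> u" "u \<le> 1" "(1 - u) * a + u * b = s" by simp_all
    have "g ((1 - u) * a + u * b) \<le> (1 - u) * g a + u * g b"
      using convex_onD[OF cv, of u a b] u ab by simp
    then show ?thesis unfolding u(3) by (simp add: H_def u_def algebra_simps diff_divide_distrib)
  qed
  then have "mean g a b - c * moment g a b
      \<le> mean (\<lambda>s. g a + H * (s - a)) a b - c * moment (\<lambda>s. g a + H * (s - a)) a b"
    by (intro weighted_mean_mono[OF ab cont_g _ _ c] continuous_intros)
  also have "\<dots> = (1/2 + c/6) * g a + (1/2 - c/6) * g b"
  proof -
    have H: "H * (b - a) = g b - g a" using ab by (simp add: H_def)
    show ?thesis unfolding mean_affine[OF ab] moment_affine[OF ab] H by (simp add: algebra_simps diff_divide_distrib add_divide_distrib)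
  qed
  finally show ?thesis .
qed

end

lemma moment_le:
  assumes "a < b" "\<And>s. s \<in> {a..b} \<Longrightarrow> (g has_real_derivative g' s) (at s)" "\<And>s. s \<in> {a..b} \<Longrightarrow> g' s \<le> G"
  shows "moment g a b \<le> G * (b - a) / 6"
proof -
  have "- G * (b - a) / 6 \<le> moment (\<lambda>s. - g s) a b"
    by (rule moment_ge[where g' = "\<lambda>s. - g' s"]) (use assms in \<open>auto intro!: derivative_eq_intros\<close>)
  then show ?thesis by (simp add: moment_def)
qed

subsection \<open>The singular kernel\<close>

definition kern_deriv :: "real \<Rightarrow> real \<Rightarrow> real \<Rightarrow> real" where
  "kern_deriv \<alpha> x s = \<alpha> * (x - s) powr (- \<alpha> - 1) / Gamma (1 - \<alpha>)"

context
  fixes \<alpha> :: real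
  assumes alpha: "0 < \<alpha>" "\<alpha> < 1"
begin

lemma Gamma_pos: "0 < Gamma (1 - \<alpha>)"
  using alpha by (intro Gamma_real_pos) auto

lemma Gamma_2_minus: "Gamma (2 - \<alpha>) = (1 - \<alpha>) * Gamma (1 - \<alpha>)"
proof -
  have "1 - \<alpha> \<notin> \<int>\<^sub>\<le>\<^sub>0" using alpha by (auto elim!: nonpos_Ints_cases)
  from Gamma_plus1[OF this] show ?thesis by (simp add: algebra_simps)
qed

lemma omega_pos: "0 < x \<Longrightarrow> 0 < omega (1 - \<alpha>) x"
  using Gamma_pos by (simp add: omega_def)

lemma omega_antimono: "0 < x \<Longrightarrow> x \<le> y \<Longrightarrow> omega (1 - \<alpha>) y \<le> omega (1 - \<alpha>) x"
  using Gamma_pos alpha by (auto simp: omega_def intro!: divide_right_mono powr_mono2')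

lemma kern_has_deriv:
  assumes "s < x"
  shows "((\<lambda>s. omega (1 - \<alpha>) (x - s)) has_real_derivative kern_deriv \<alpha> x s) (at s)"
proof -
  have "((\<lambda>s. (x - s) powr (- \<alpha>)) has_real_derivative \<alpha> * (x - s) powr (- \<alpha> - 1)) (at s)"
    using assms by (auto intro!: derivative_eq_intros simp: powr_diff)
  from DERIV_cdivide[OF this, of "Gamma (1 - \<alpha>)"] show ?thesis
    by (simp add: omega_def kern_deriv_def)
qed

lemma kern_deriv_nonneg: "0 \<le> kern_deriv \<alpha> x s"
  using Gamma_pos alpha by (simp add: kern_deriv_def)

lemma kern_deriv_mono: "s \<le> u \<Longrightarrow> u < x \<Longrightarrow> kern_deriv \<alpha> x s \<le> kern_deriv \<alpha> x u"
  using Gamma_pos alpha unfolding kern_deriv_def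
  by (intro divide_right_mono mult_left_mono powr_mono2') auto

lemma kern_deriv_antimono: "s < x \<Longrightarrow> x \<le> y \<Longrightarrow> kern_deriv \<alpha> y s \<le> kern_deriv \<alpha> x s"
  using Gamma_pos alpha unfolding kern_deriv_def
  by (intro divide_right_mono mult_left_mono powr_mono2') auto

text \<open>Euler's relation for a kernel homogeneous of degree -\<alpha>; it converts a slope bound
  into a bound by the kernel value.\<close>

lemma kern_deriv_eq: "s < x \<Longrightarrow> (x - s) * kern_deriv \<alpha> x s = \<alpha> * omega (1 - \<alpha>) (x - s)"
  by (simp add: kern_deriv_def omega_def powr_diff)

text \<open>The second derivative decreases with the distance to the singularity, so the difference
  of two kernels is convex again, and bounds for convex increasing functions apply to it.\<close>

lemma kern_deriv_diff_mono:
  assumes "s \<le> u" "u < x" "x \<le> y"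
  shows "kern_deriv \<alpha> x s - kern_deriv \<alpha> y s \<le> kern_deriv \<alpha> x u - kern_deriv \<alpha> y u"
proof (rule DERIV_nonneg_imp_nondecreasing[OF assms(1)])
  fix r assume "s \<le> r" "r \<le> u"
  then have r: "r < x" "r < y" using assms by auto
  let ?d = "\<lambda>x. \<alpha> * ((\<alpha> + 1) * (x - r) powr (- \<alpha> - 2)) / Gamma (1 - \<alpha>)"
  have "((\<lambda>s. kern_deriv \<alpha> x s - kern_deriv \<alpha> y s) has_real_derivative ?d x - ?d y) (at r)"
  proof -
    have "((\<lambda>s. (z - s) powr (- \<alpha> - 1)) has_real_derivative (\<alpha> + 1) * (z - r) powr (- \<alpha> - 2)) (at r)"
      if "r < z" for z
    proof -
      have "(z - r) powr (- \<alpha> - 2) = (z - r) powr (- \<alpha> - 1) / (z - r)"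
        using that powr_diff[of "z - r" "- \<alpha> - 1" 1] by (simp add: minus_diff_commute)
      then show ?thesis using that by (auto intro!: derivative_eq_intros simp: algebra_simps)
    qed
    then have "((\<lambda>s. kern_deriv \<alpha> z s) has_real_derivative ?d z) (at r)" if "r < z" for z
      unfolding kern_deriv_def using that by (intro DERIV_cdivide DERIV_cmult) auto
    then show ?thesis using r by (intro DERIV_diff) auto
  qed
  moreover have "?d y \<le> ?d x"
    using Gamma_pos alpha r assms by (intro divide_right_mono mult_left_mono powr_mono2') auto
  ultimately show "\<exists>d. ((\<lambda>s. kern_deriv \<alpha> x s - kern_deriv \<alpha> y s) has_real_derivative d) (at r) \<and> 0 \<le> d"
    by (intro exI[of _ "?d x - ?d y"]) simp
qed

lemma kern_integral:
  assumes "0 < y"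
  shows "integral {x - y..x} (\<lambda>s. omega (1 - \<alpha>) (x - s)) = omega (2 - \<alpha>) y"
proof -
  let ?F = "\<lambda>s. - ((x - s) powr (1 - \<alpha>) / (1 - \<alpha>) / Gamma (1 - \<alpha>))"
  have "((\<lambda>s. omega (1 - \<alpha>) (x - s)) has_integral ?F x - ?F (x - y)) {x - y..x}"
  \<comment> \<open>The integrand is singular at \<open>x\<close>; only the antiderivative extends
    continuously to that end, since 1 - \<alpha> > 0.\<close>
  proof (rule fundamental_theorem_of_calculus_interior)
    show "continuous_on {x - y..x} ?F"
    proof -
      have "continuous_on {x - y..x} (\<lambda>s. (x - s) powr (1 - \<alpha>))"
        using alpha by (intro continuous_on_powr' continuous_intros) auto
      moreover have "Gamma (1 - \<alpha>) \<noteq> 0" using Gamma_pos by (metis less_irrefl)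
      ultimately show ?thesis using alpha
        by (intro continuous_on_minus continuous_on_divide continuous_on_const) auto
    qed
    fix s assume s: "s \<in> {x - y<..<x}"
    have "(?F has_real_derivative omega (1 - \<alpha>) (x - s)) (at s)"
    proof -
      have "((\<lambda>s. (x - s) powr (1 - \<alpha>)) has_real_derivative - ((1 - \<alpha>) * (x - s) powr (- \<alpha>))) (at s)"
        using s DERIV_fun_powr[of "\<lambda>s. x - s" "- 1" s "1 - \<alpha>"]
        by (auto intro!: derivative_eq_intros)
      from DERIV_minus[OF DERIV_cdivide[OF DERIV_cdivide[OF this, of "1 - \<alpha>"], of "Gamma (1 - \<alpha>)"]]
      show ?thesis using alpha by (simp add: omega_def)
    qed
    then show "(?F has_vector_derivative omega (1 - \<alpha>) (x - s)) (at s)"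
      by (simp add: has_real_derivative_iff_has_vector_derivative)
  qed (use assms in auto)
  then have "integral {x - y..x} (\<lambda>s. omega (1 - \<alpha>) (x - s)) = y powr (1 - \<alpha>) / (1 - \<alpha>) / Gamma (1 - \<alpha>)"
    by (simp add: integral_unique)
  also have "\<dots> = omega (2 - \<alpha>) y" unfolding omega_def Gamma_2_minus by (simp add: algebra_simps)
  finally show ?thesis .
qed

lemma omega_2_minus: "0 < y \<Longrightarrow> (1 - \<alpha>) * omega (2 - \<alpha>) y = y * omega (1 - \<alpha>) y"
proof -
  assume y: "0 < y"
  have "y powr (2 - \<alpha> - 1) = y * y powr (1 - \<alpha> - 1)"
    using y powr_add[of y 1 "- \<alpha>"] by simp
  then show ?thesis unfolding omega_def Gamma_2_minus using alpha by simp
qed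

text \<open>The factor \<open>2 (1 - \<alpha>) / (2 - \<alpha>)\<close> turns the truncated mean \<open>a\<^sub>0\<close> into the value of the kernel at the
  left end of the last step.\<close>

lemma akern_0:
  assumes "t (n - 1) < t n"
  shows "akern \<alpha> (\<alpha>/2) t n 0 = omega (2 - \<alpha>) ((1 - \<alpha>/2) * tau t n) / tau t n"
    and "2 * (1 - \<alpha>) / (2 - \<alpha>) * akern \<alpha> (\<alpha>/2) t n 0 = omega (1 - \<alpha>) (tth t (\<alpha>/2) n - t (n - 1))"
proof -
  let ?y = "(1 - \<alpha>/2) * tau t n"
  have tt: "tth t (\<alpha>/2) n - ?y = t (n - 1)" "tth t (\<alpha>/2) n - t (n - 1) = ?y"
    by (simp_all add: tth_def tau_def algebra_simps)
  have y: "0 < ?y" using assms alpha by (simp add: tau_def)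
  have "min (t n) (tth t (\<alpha>/2) n) = tth t (\<alpha>/2) n"
  proof -
    have "t n - tth t (\<alpha>/2) n = \<alpha>/2 * (t n - t (n - 1))" by (simp add: tth_def algebra_simps)
    moreover have "0 < \<alpha>/2 * (t n - t (n - 1))" using assms alpha by simp
    ultimately show ?thesis by simp
  qed
  then show a0: "akern \<alpha> (\<alpha>/2) t n 0 = omega (2 - \<alpha>) ?y / tau t n"
    using kern_integral[OF y, of "tth t (\<alpha>/2) n"] unfolding tt(1)
    by (simp add: akern_def varpi'_def[abs_def] Let_def)
  have "2 * (1 - \<alpha>) / (2 - \<alpha>) * (omega (2 - \<alpha>) ?y / tau t n)
      = 2 / (2 - \<alpha>) / tau t n * ((1 - \<alpha>) * omega (2 - \<alpha>) ?y)" by simp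
  also have "\<dots> = 2 / (2 - \<alpha>) / tau t n * (?y * omega (1 - \<alpha>) ?y)"
    by (simp only: omega_2_minus[OF y])
  also have "\<dots> = omega (1 - \<alpha>) ?y"
  proof -
    have "2 / (2 - \<alpha>) / \<tau> * ((1 - \<alpha>/2) * \<tau> * z) = z" if "\<tau> \<noteq> 0" for \<tau> z :: real
      using alpha that by (simp add: field_simps)
    from this[of "tau t n" "omega (1 - \<alpha>) ?y"] show ?thesis using assms by (simp only: tau_def)
  qed
  finally show "2 * (1 - \<alpha>) / (2 - \<alpha>) * akern \<alpha> (\<alpha>/2) t n 0 = omega (1 - \<alpha>) (tth t (\<alpha>/2) n - t (n - 1))"
    unfolding a0 tt(2) .
qed

text \<open>The kernel value is \<open>omega (2 - \<alpha>) (1 - \<alpha>/2) / tau t n powr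
  \<alpha>\<close>, so an upper bound on the step is a lower bound on it. Both step restrictions
  have this form, each with its own \<open>c\<close>.\<close>

lemma akern_0_ge:
  assumes t: "t (n - 1) < t n" and c: "0 < c"
    and le: "tau t n \<le> (c * omega (2 - \<alpha>) (1 - \<alpha>/2)) powr (1/\<alpha>)"
  shows "1 \<le> c * akern \<alpha> (\<alpha>/2) t n 0"
proof -
  have tp: "0 < tau t n" using t by (simp add: tau_def)
  have om: "0 < omega (2 - \<alpha>) (1 - \<alpha>/2)"
    using alpha by (simp add: omega_def Gamma_real_pos)
  have "tau t n powr \<alpha> \<le> ((c * omega (2 - \<alpha>) (1 - \<alpha>/2)) powr (1/\<alpha>)) powr \<alpha>"
    using le tp alpha by (intro powr_mono2) auto
  also have "\<dots> = c * omega (2 - \<alpha>) (1 - \<alpha>/2)"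
    using alpha c om by (simp add: powr_powr)
  finally have "tau t n powr \<alpha> \<le> c * omega (2 - \<alpha>) (1 - \<alpha>/2)" .
  moreover have "akern \<alpha> (\<alpha>/2) t n 0 = omega (2 - \<alpha>) (1 - \<alpha>/2) / tau t n powr \<alpha>"
    unfolding akern_0(1)[OF t] omega_def using tp alpha
    by (simp add: powr_mult powr_diff)
  ultimately show ?thesis using tp by simp
qed

end

subsection \<open>The ratio threshold\<close>

text \<open>The defining function is strictly increasing for r > 0 and changes sign on [77/200, 1],
  so the description operator picks a root there. 77/200 lies just below the limit of the root as
  \<alpha> tends to 0, where the root is smallest.\<close>

lemma r_star_ge:
  assumes alpha: "0 < \<alpha>" "\<alpha> < 1"
  shows "77/200 \<le> r_star \<alpha>"
proof -
  define P where "P r = 2 * sqrt (2 * (1 - \<alpha>/2) * r / (1 + \<alpha> + (1 - \<alpha>/2) * r) + r / (1 + r))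
       + 3 - 1 / (r^2 * (1 + r))" for r
  let ?X = "\<lambda>r. 2 * (1 - \<alpha>/2) * r / (1 + \<alpha> + (1 - \<alpha>/2) * r) + r / (1 + r)"
  have mono: "P r < P s" if "0 < r" "r < s" for r s
  proof -
    have "r / (1 + r) \<le> s / (1 + s)" using that by (simp add: field_simps)
    moreover have "2 * (1 - \<alpha>/2) * r / (1 + \<alpha> + (1 - \<alpha>/2) * r) \<le> 2 * (1 - \<alpha>/2) * s / (1 + \<alpha> + (1 - \<alpha>/2) * s)"
    proof (rule frac_le_eq[THEN iffD2])
      define k where "k = 1 - \<alpha>/2"
      have k: "0 < k" using alpha by (simp add: k_def)
      show "1 + \<alpha> + (1 - \<alpha>/2) * r \<noteq> 0" "1 + \<alpha> + (1 - \<alpha>/2) * s \<noteq> 0"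
        unfolding k_def[symmetric] using that alpha k
        by (metis add_pos_pos less_numeral_extra(1,3) mult_pos_pos order.strict_trans)+
      have "2 * k * r * (1 + \<alpha> + k * s) - 2 * k * s * (1 + \<alpha> + k * r) = 2 * k * (1 + \<alpha>) * (r - s)"
        by (simp add: algebra_simps)
      also have "\<dots> \<le> 0" using k alpha that by (intro mult_nonneg_nonpos) auto
      finally have "2 * k * r * (1 + \<alpha> + k * s) - 2 * k * s * (1 + \<alpha> + k * r) \<le> 0" .
      then show "(2 * (1 - \<alpha>/2) * r * (1 + \<alpha> + (1 - \<alpha>/2) * s) - 2 * (1 - \<alpha>/2) * s * (1 + \<alpha> + (1 - \<alpha>/2) * r)) /
          ((1 + \<alpha> + (1 - \<alpha>/2) * r) * (1 + \<alpha> + (1 - \<alpha>/2) * s)) \<le> 0"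
        unfolding k_def[symmetric] using that alpha k by (intro divide_nonpos_pos mult_pos_pos add_pos_pos) auto
    qed
    ultimately have "sqrt (?X r) \<le> sqrt (?X s)" by simp
    moreover have "1 / (s^2 * (1 + s)) < 1 / (r^2 * (1 + r))"
      using that by (intro divide_strict_left_mono mult_strict_mono power_strict_mono mult_pos_pos) auto
    ultimately show ?thesis unfolding P_def by linarith
  qed
  have low: "P (77/200) < 0"
  proof -
    \<comment> \<open>The fraction is largest at \<alpha> = 0, with value 154/277. The root is then
      at most 0.92, and 2 * 0.92 + 3 = 4.84 stays below 4.85.\<close>
    have "2 * (1 - \<alpha>/2) * (77/200) / (1 + \<alpha> + (1 - \<alpha>/2) * (77/200)) \<le> 154/277"
      using alpha by (simp add: field_simps)
    then have "?X (77/200) \<le> 154/277 + 77/277" by (rule add_mono) simp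
    also have "\<dots> \<le> (92/100)^2" by (simp add: power2_eq_square)
    finally have "sqrt (?X (77/200)) \<le> sqrt ((92/100)^2)" by (rule real_sqrt_le_mono)
    moreover have "sqrt ((92/100)^2) = (92/100::real)" by (rule real_sqrt_abs[THEN trans]) simp
    moreover have "485/100 < 1 / ((77/200)^2 * (1 + 77/200::real))" by (simp add: power2_eq_square)
    ultimately show ?thesis unfolding P_def by linarith
  qed
  have high: "0 \<le> P 1"
  proof -
    have "0 \<le> ?X 1" using alpha by (intro add_nonneg_nonneg divide_nonneg_nonneg) auto
    then have "0 \<le> sqrt (?X 1)" by simp
    then show ?thesis unfolding P_def by simp
  qed
  have "\<exists>r. 77/200 \<le> r \<and> r \<le> 1 \<and> P r = 0"
  proof (rule IVT')
    have "1 + \<alpha> + (1 - \<alpha>/2) * r \<noteq> 0" if "77/200 \<le> r" for r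
    proof -
      have "0 \<le> (1 - \<alpha>/2) * r" using that alpha by (intro mult_nonneg_nonneg) auto
      then show ?thesis using alpha by linarith
    qed
    then show "continuous_on {77/200..1} P"
      unfolding P_def by (auto intro!: continuous_intros)
  qed (use low high in auto)
  then obtain r where r: "77/200 \<le> r" "P r = 0" by auto
  have "r_star \<alpha> = r"
    unfolding r_star_def P_def[symmetric]
  proof (rule the_equality)
    show "0 < r \<and> P r = 0" using r by simp
    fix s assume "0 < s \<and> P s = 0"
    then show "s = r" using mono[of s r] mono[of r s] r by (cases s r rule: linorder_cases) auto
  qed
  then show ?thesis using r by simp
qed

subsection \<open>Kernels on a mesh with bounded-below step ratios\<close>

locale graded_mesh =
  fixes \<alpha> :: real and t :: "nat \<Rightarrow> real" and N :: nat
  assumes alpha: "0 < \<alpha>" "\<alpha> < 1"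
    and step_pos: "\<And>k. 1 \<le> k \<Longrightarrow> k \<le> N \<Longrightarrow> t (k - 1) < t k"
    and ratio_ge: "\<And>k. 2 \<le> k \<Longrightarrow> k \<le> N \<Longrightarrow> 77/200 \<le> rr t k"
begin

abbreviation node :: "nat \<Rightarrow> real" where "node \<equiv> tth t (\<alpha>/2)"

definition ker :: "nat \<Rightarrow> real \<Rightarrow> real" where
  "ker n s = omega (1 - \<alpha>) (node n - s)"

abbreviation dker :: "nat \<Rightarrow> real \<Rightarrow> real" where "dker n \<equiv> kern_deriv \<alpha> (node n)"

definition mn :: "(real \<Rightarrow> real) \<Rightarrow> nat \<Rightarrow> real" where
  "mn f k = mean f (t (k - 1)) (t k)"

text \<open>The value 0 at \<open>k = 0\<close> stands for the missing interval before the first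
  one; it merges the separate first-interval case of \<open>ahat\<close> with the general
  one.\<close>

definition mo :: "(real \<Rightarrow> real) \<Rightarrow> nat \<Rightarrow> real" where
  "mo f k = (if k = 0 then 0 else moment f (t (k - 1)) (t k))"

text \<open>\<open>low\<close> and \<open>upp\<close> are the two halves of a kernel increment: the contributions of the intervals
  \<open>k - 1\<close>, \<open>k\<close> and of the interval \<open>k + 1\<close>, see \<open>bk_diff\<close>.\<close>

definition low :: "(real \<Rightarrow> real) \<Rightarrow> nat \<Rightarrow> real" where
  "low f k = f (t k) - mn f k + mo f k / rr t (k + 1) - mo f (k - 1) / (rr t k * (1 + rr t k))"

definition upp :: "(real \<Rightarrow> real) \<Rightarrow> nat \<Rightarrow> real" where
  "upp f k = mn f k - f (t (k - 1)) - mo f k / (1 + rr t (k + 1))"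

text \<open>Indexed by the mesh interval \<open>k\<close> instead of the lag \<open>n - k\<close>,
  so that kernels of different levels are compared on the same interval.\<close>

definition bk :: "nat \<Rightarrow> nat \<Rightarrow> real" where
  "bk n k = ahat \<alpha> (\<alpha>/2) t n (n - k)"

section \<open>Elementary facts on mesh, nodes and kernels\<close>

lemma tau_pos: "1 \<le> k \<Longrightarrow> k \<le> N \<Longrightarrow> 0 < tau t k"
  using step_pos[of k] by (simp add: tau_def)

lemma rr_pos: "2 \<le> k \<Longrightarrow> k \<le> N \<Longrightarrow> 0 < rr t k"
  using ratio_ge[of k] by linarith

lemma tau_pred: "2 \<le> k \<Longrightarrow> k \<le> N \<Longrightarrow> tau t k = rr t k * tau t (k - 1)"
proof -
  assume k: "2 \<le> k" "k \<le> N"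
  have "0 < tau t (k - 1)" by (rule tau_pos) (use k in auto)
  then show ?thesis by (simp add: rr_def)
qed

lemma t_mono: "i \<le> j \<Longrightarrow> j \<le> N \<Longrightarrow> t i \<le> t j"
proof (induction j rule: dec_induct)
  case (step j)
  then show ?case using step_pos[of "Suc j"] by auto
qed simp

lemma node_eq: "node n = t (n - 1) + (1 - \<alpha>/2) * tau t n"
  by (simp add: tth_def tau_def algebra_simps)

lemma node_gt: "1 \<le> n \<Longrightarrow> n \<le> N \<Longrightarrow> t (n - 1) < node n"
  using tau_pos[of n] alpha by (simp add: node_eq)

lemma node_lt: "1 \<le> n \<Longrightarrow> n \<le> N \<Longrightarrow> node n < t n"
proof -
  assume "1 \<le> n" "n \<le> N"
  then have "0 < \<alpha>/2 * tau t n" using tau_pos[of n] alpha by simp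
  moreover have "t n - node n = \<alpha>/2 * tau t n" by (simp add: tth_def tau_def algebra_simps)
  ultimately show ?thesis by simp
qed

lemma node_mono:
  assumes "1 \<le> m" "m < n" "n \<le> N"
  shows "node m < node n"
proof -
  have "t m \<le> t (n - 1)" by (rule t_mono) (use assms in auto)
  then show ?thesis using node_lt[of m] node_gt[of n] assms by simp
qed

lemma t_lt_node: "k < n \<Longrightarrow> n \<le> N \<Longrightarrow> t k < node n"
proof -
  assume k: "k < n" "n \<le> N"
  then have "t k \<le> t (n - 1)" by (intro t_mono) auto
  then show ?thesis using node_gt[of n] k by simp
qed

lemma ker_deriv: "s < node n \<Longrightarrow> (ker n has_real_derivative dker n s) (at s)"
  unfolding ker_def[abs_def] by (rule kern_has_deriv[OF alpha])

lemma ker_pos: "s < node n \<Longrightarrow> 0 < ker n s"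
  unfolding ker_def by (intro omega_pos[OF alpha]) simp

lemma ker_antimono: "s < node m \<Longrightarrow> node m \<le> node n \<Longrightarrow> ker n s \<le> ker m s"
  unfolding ker_def by (intro omega_antimono[OF alpha]) simp_all

lemma ker_mono: "s \<le> u \<Longrightarrow> u < node n \<Longrightarrow> ker n s \<le> ker n u"
  unfolding ker_def by (intro omega_antimono[OF alpha]) simp_all

lemma ker_cont:
  assumes "k < n" "n \<le> N"
  shows "continuous_on {t (k - 1)..t k} (ker n)"
  by (intro continuous_at_imp_continuous_on ballI DERIV_isCont[OF ker_deriv])
    (use t_lt_node[OF assms] in auto)

section \<open>The kernels of the scheme as means and moments\<close>

lemma varpi_eq: "varpi' \<alpha> (\<alpha>/2) t n = ker n"
  by (simp add: varpi'_def ker_def fun_eq_iff)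

lemma akern_eq: "1 \<le> k \<Longrightarrow> k < n \<Longrightarrow> n \<le> N \<Longrightarrow> akern \<alpha> (\<alpha>/2) t n (n - k) = mn (ker n) k"
  using t_lt_node[of k n] by (simp add: akern_def varpi_eq mn_def mean_def tau_def Let_def min_def)

lemma zeta_eq: "1 \<le> k \<Longrightarrow> k < n \<Longrightarrow> zeta \<alpha> (\<alpha>/2) t n (n - k) = mo (ker n) k"
  by (simp add: zeta_def varpi_eq mo_def moment_def tau_def Let_def)

lemma bk_eq:
  assumes "1 \<le> k" "k < n" "n \<le> N"
  shows "bk n k = mn (ker n) k + mo (ker n) (k - 1) / (rr t k * (1 + rr t k)) - mo (ker n) k / (1 + rr t (k + 1))"
proof (cases "k = 1")
  case True
  then show ?thesis using assms akern_eq[of 1 n] zeta_eq[of 1 n]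
    by (simp add: bk_def ahat_def mo_def numeral_2_eq_2)
next
  case False
  then have "n - k + 1 = n - (k - 1)" "n - (n - k) = k" "n - k \<noteq> 0" "n - k \<noteq> n - 1" using assms by auto
  then show ?thesis using False assms akern_eq[of k n] zeta_eq[of k n] zeta_eq[of "k - 1" n]
    by (simp add: bk_def ahat_def Let_def)
qed

lemma bk_top:
  assumes "1 \<le> n" "n \<le> N"
  shows "bk n n = ker n (t (n - 1)) + mo (ker n) (n - 1) / (rr t n * (1 + rr t n))"
proof (cases "n = 1")
  case True
  then show ?thesis using akern_0(2)[OF alpha step_pos[OF assms]]
    by (simp add: bk_def ahat_def mo_def ker_def)
next
  case False
  then have "1 = n - (n - 1)" using assms by simp
  then have "zeta \<alpha> (\<alpha>/2) t n 1 = mo (ker n) (n - 1)" using zeta_eq[of "n - 1" n] False assms by simp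
  then show ?thesis using False akern_0(2)[OF alpha step_pos[OF assms]]
    by (simp add: bk_def ahat_def ker_def)
qed

text \<open>Interval \<open>k\<close> enters two consecutive kernels with these two moment
  coefficients, \<open>r\<close> being the ratio at \<open>k + 1\<close>; they merge into the term
  of \<open>low\<close>.\<close>

lemma split_ratio: "0 < r \<Longrightarrow> x / (r * (1 + r)) + x / (1 + r) = x / (r::real)"
proof -
  assume "0 < r"
  then have "r \<noteq> 0" "1 + r \<noteq> 0" by auto
  then show ?thesis by (simp add: divide_simps) (simp add: algebra_simps)
qed

lemma bk_diff:
  assumes "1 \<le> k" "k + 1 < n" "n \<le> N"
  shows "bk n (k + 1) - bk n k = low (ker n) k + upp (ker n) (k + 1)"
  using assms split_ratio[OF rr_pos[of "k + 1"], of "mo (ker n) k"]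
  by (simp add: bk_eq low_def upp_def)

text \<open>The top kernel carries the point value of the kernel at \<open>t k\<close> in place of a
  mean over the last interval, so no \<open>upp\<close> part arises.\<close>

lemma bk_diff_top:
  assumes "1 \<le> k" "k + 1 \<le> N"
  shows "bk (k + 1) (k + 1) - bk (k + 1) k = low (ker (k + 1)) k"
  using assms split_ratio[OF rr_pos[of "k + 1"], of "mo (ker (k + 1)) k"] bk_top[of "k + 1"]
  by (simp add: bk_eq low_def)

lemma low_diff:
  assumes "1 \<le> k" "k + 1 \<le> N" "continuous_on {t (k - 1)..t k} f" "continuous_on {t (k - 1)..t k} g"
    "continuous_on {t (k - 1 - 1)..t (k - 1)} f" "continuous_on {t (k - 1 - 1)..t (k - 1)} g"
  shows "low (\<lambda>s. f s - g s) k = low f k - low g k"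
  using assms by (simp add: low_def mn_def mo_def mean_diff moment_diff diff_divide_distrib)

lemma upp_diff:
  assumes "continuous_on {t (k - 1)..t k} f" "continuous_on {t (k - 1)..t k} g"
  shows "upp (\<lambda>s. f s - g s) k = upp f k - upp g k"
  using assms by (simp add: upp_def mn_def mo_def mean_diff moment_diff diff_divide_distrib)

section \<open>Lower bounds for kernel increments of convex increasing functions\<close>

context
  fixes f f' :: "real \<Rightarrow> real" and k :: nat
  assumes k: "1 \<le> k" "k + 1 \<le> N"
    and df: "\<And>s. s \<le> t k \<Longrightarrow> (f has_real_derivative f' s) (at s)"
    and f'_mono: "\<And>s u. s \<le> u \<Longrightarrow> u \<le> t k \<Longrightarrow> f' s \<le> f' u"
    and f'_nonneg: "\<And>s. s \<le> t k \<Longrightarrow> 0 \<le> f' s"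
begin

text \<open>\<open>?G\<close> is the largest slope on interval \<open>k - 1\<close> and the smallest
  on interval \<open>k\<close>. In units of \<open>tau t k * ?G / 6\<close>, the mean gains 3, the
  moment of interval \<open>k\<close> gains \<open>1 / rr t (k + 1)\<close>, and the moment of
  interval \<open>k - 1\<close> costs at most 39/8; 15/8 = 39/8 - 3.\<close>

lemma low_ge: "tau t k * f' (t (k - 1)) * (1 / rr t (k + 1) - 15/8) / 6 \<le> low f k"
proof -
  let ?G = "f' (t (k - 1))"
  let ?r = "rr t k"
  have st: "t (k - 1) < t k" and tp: "0 < tau t k" using step_pos[of k] tau_pos[of k] k by auto
  have r': "0 < rr t (k + 1)" using rr_pos[of "k + 1"] k by simp
  have mn: "mn f k \<le> f (t k) - ?G * tau t k / 2"
    unfolding mn_def tau_def by (rule mean_le_end[OF st, where g' = f']) (auto intro: df f'_mono)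
  have "?G * tau t k / 6 \<le> mo f k"
    using k moment_ge[OF st, where g' = f' and g = f and G = ?G] by (auto simp: mo_def tau_def df f'_mono)
  then have m1: "?G * tau t k / 6 / rr t (k + 1) \<le> mo f k / rr t (k + 1)"
    using r' by (intro divide_right_mono) auto
  have m2: "mo f (k - 1) / (?r * (1 + ?r)) \<le> ?G * tau t k * (39/8) / 6"
  proof (cases "k = 1")
    case True
    then show ?thesis using f'_nonneg[of "t 0"] st tp by (simp add: mo_def)
  next
    case False
    then have k2: "2 \<le> k" using k by simp
    have st': "t (k - 1 - 1) < t (k - 1)" using step_pos[of "k - 1"] k2 k by simp
    have r: "77/200 \<le> ?r" using ratio_ge[of k] k2 k by simp
    have "mo f (k - 1) \<le> ?G * tau t (k - 1) / 6"
      using k2 moment_le[OF st', where g' = f' and g = f and G = ?G] st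
      by (auto simp: mo_def tau_def df f'_mono)
    then have "mo f (k - 1) / (?r * (1 + ?r)) \<le> ?G * tau t (k - 1) / 6 / (?r * (1 + ?r))"
      using r by (intro divide_right_mono) auto
    also have "\<dots> = ?G * tau t k / 6 * (1 / (?r^2 * (1 + ?r)))"
      using tau_pred[of k] r k2 k by (simp add: power2_eq_square)
    also have "\<dots> \<le> ?G * tau t k / 6 * (39/8)"
    proof (rule mult_left_mono)
      \<comment> \<open>Here the ratio bound enters: r^2 (1 + r) at r = 77/200 is just above
        8/39.\<close>
      have "(77/200)^2 * (1 + 77/200) \<le> ?r^2 * (1 + ?r)"
        using r by (intro mult_mono power_mono) auto
      then have "8/39 \<le> ?r^2 * (1 + ?r)" by (simp add: power2_eq_square)
      then show "1 / (?r^2 * (1 + ?r)) \<le> 39/8" using r by (simp add: field_simps)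
    qed (use f'_nonneg[of "t (k - 1)"] st tp in auto)
    finally show ?thesis by simp
  qed
  have "?G * tau t k / 2 + ?G * tau t k / 6 / rr t (k + 1) - ?G * tau t k * (39/8) / 6 \<le> low f k"
    unfolding low_def using mn m1 m2 by linarith
  then show ?thesis by (simp add: algebra_simps)
qed

lemma upp_ge: "tau t k * f' (t (k - 1)) / 3 \<le> upp f k"
proof -
  let ?G = "f' (t (k - 1))" and ?c = "1 / (1 + rr t (k + 1))"
  have st: "t (k - 1) < t k" using step_pos[of k] k by auto
  have c: "0 \<le> ?c" "?c \<le> 1" using rr_pos[of "k + 1"] k by auto
  have "f (t (k - 1)) + ?G * tau t k * (1/2 - ?c/6) \<le> mn f k - ?c * mo f k"
    using weighted_mean_ge_start[OF st, where g' = f' and g = f and G = ?G and c = ?c] c k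
    by (auto simp: mn_def mo_def tau_def df f'_mono)
  moreover have "?G * tau t k * (1/3) \<le> ?G * tau t k * (1/2 - ?c/6)"
  proof (rule mult_left_mono)
    have "1/3 \<le> 1/2 - x/6" if "x \<le> 1" for x :: real using that by linarith
    then show "1/3 \<le> 1/2 - ?c/6" using c(2) .
  qed (use tau_pos[of k] k f'_nonneg[of "t (k - 1)"] st in auto)
  ultimately show ?thesis by (simp add: upp_def algebra_simps)
qed

end

text \<open>A large ratio makes \<open>low\<close> negative, but \<open>upp\<close> then gains over
  the longer interval: since \<open>tau t (k + 1) = ?r * tau t k\<close>, the sum is governed by 1 -
  15/8 r + 2 r^2, which has negative discriminant.\<close>

lemma low_upp_nonneg:
  assumes k: "1 \<le> k" "k + 2 \<le> N"
    and df: "\<And>s. s \<le> t (k + 1) \<Longrightarrow> (f has_real_derivative f' s) (at s)"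
    and f'_mono: "\<And>s u. s \<le> u \<Longrightarrow> u \<le> t (k + 1) \<Longrightarrow> f' s \<le> f' u"
    and f'_nonneg: "\<And>s. s \<le> t (k + 1) \<Longrightarrow> 0 \<le> f' s"
  shows "0 \<le> low f k + upp f (k + 1)"
proof -
  let ?G = "f' (t (k - 1))" and ?r = "rr t (k + 1)"
  have le: "t (k - 1) \<le> t k" "t k \<le> t (k + 1)" using t_mono k by auto
  have tp: "0 < tau t k" "0 < tau t (k + 1)" and r: "0 < ?r"
    using tau_pos rr_pos[of "k + 1"] k by auto
  have "tau t k * ?G * (1 / ?r - 15/8) / 6 \<le> low f k"
    by (rule low_ge) (use k le in \<open>auto intro: df f'_mono f'_nonneg\<close>)
  moreover have "tau t (k + 1) * f' (t (k + 1 - 1)) / 3 \<le> upp f (k + 1)"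
    by (rule upp_ge) (use k le in \<open>auto intro: df f'_mono f'_nonneg\<close>)
  moreover have "?r * tau t k * ?G / 3 \<le> tau t (k + 1) * f' (t (k + 1 - 1)) / 3"
    using tau_pred[of "k + 1"] k tp f'_mono[of "t (k - 1)" "t k"] le r by simp
  moreover have "0 \<le> tau t k * ?G * (1 / ?r - 15/8) / 6 + ?r * tau t k * ?G / 3"
  proof -
    have "0 \<le> (?r - 1)^2 + ?r^2 + ?r / 8" using r by simp
    then have "15/8 * ?r \<le> 1 + 2 * ?r^2" by (simp add: power2_eq_square algebra_simps)
    then have "0 \<le> 1 / ?r - 15/8 + 2 * ?r" using r by (simp add: field_simps power2_eq_square)
    then have "0 \<le> tau t k * ?G * (1 / ?r - 15/8 + 2 * ?r) / 6"
      using tp f'_nonneg[of "t (k - 1)"] le by (intro divide_nonneg_nonneg mult_nonneg_nonneg) auto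
    then show ?thesis by (simp add: algebra_simps diff_divide_distrib add_divide_distrib)
  qed
  ultimately show ?thesis by linarith
qed

text \<open>Without an \<open>upp\<close> part the loss remains, but it is at most
  \<open>tau t k * ?G * (1 + (1 - \<alpha>/2) * ?r) / 8\<close>. There
  \<open>tau t k * (1 + (1 - \<alpha>/2) * ?r)\<close> is the distance from \<open>t (k - 1)\<close>
  to the node, so homogeneity turns slope times distance into \<alpha> times the kernel.\<close>

lemma low_ker_ge:
  assumes k: "1 \<le> k" "k + 1 \<le> N"
    and df: "\<And>s. s \<le> t k \<Longrightarrow> (f has_real_derivative f' s) (at s)"
    and f'_mono: "\<And>s u. s \<le> u \<Longrightarrow> u \<le> t k \<Longrightarrow> f' s \<le> f' u"
    and f'_nonneg: "\<And>s. s \<le> t k \<Longrightarrow> 0 \<le> f' s"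
    and le: "f' (t (k - 1)) \<le> dker (k + 1) (t (k - 1))"
  shows "- (\<alpha>/8 * ker (k + 1) (t k)) \<le> low f k"
proof -
  let ?G = "f' (t (k - 1))" and ?r = "rr t (k + 1)" and ?K = "dker (k + 1) (t (k - 1))"
  have tp: "0 < tau t k" and r: "0 < ?r" using tau_pos[of k] rr_pos[of "k + 1"] k by auto
  have st: "t (k - 1) < t k" "t k < node (k + 1)" using step_pos[of k] t_lt_node[of k "k + 1"] k by auto
  have 1: "tau t k * ?G * (1 / ?r - 15/8) / 6 \<le> low f k"
    by (rule low_ge) (use k in \<open>auto intro: df f'_mono f'_nonneg\<close>)
  have "(15/8 - 1 / ?r) / 6 \<le> (1 + ?r / 2) / 8"
  proof -
    \<comment> \<open>The difference of the two sides is 3 (r - 3/2)^2 + 5/4.\<close>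
    have "9 * ?r \<le> 8 + 3 * ?r^2" using zero_le_power2[of "?r - 3/2"]
      by (simp add: power2_eq_square algebra_simps)
    then show ?thesis using r by (simp add: field_simps power2_eq_square)
  qed
  also have "\<dots> \<le> (1 + (1 - \<alpha>/2) * ?r) / 8"
  proof -
    have "1/2 * ?r \<le> (1 - \<alpha>/2) * ?r" using r alpha by (intro mult_right_mono) auto
    then show ?thesis by (intro divide_right_mono) auto
  qed
  finally have 2: "(15/8 - 1 / ?r) / 6 \<le> (1 + (1 - \<alpha>/2) * ?r) / 8" .
  have 3: "node (k + 1) - t (k - 1) = tau t k * (1 + (1 - \<alpha>/2) * ?r)"
    using tau_pred[of "k + 1"] k node_eq[of "k + 1"] by (simp add: algebra_simps) (simp add: tau_def)
  have pos: "0 \<le> (1 + (1 - \<alpha>/2) * ?r) / 8" using alpha r by simp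
  have "tau t k * ?G * ((15/8 - 1 / ?r) / 6) \<le> tau t k * ?G * ((1 + (1 - \<alpha>/2) * ?r) / 8)"
    using 2 tp f'_nonneg[of "t (k - 1)"] st by (intro mult_left_mono mult_nonneg_nonneg) auto
  also have "\<dots> \<le> tau t k * ?K * ((1 + (1 - \<alpha>/2) * ?r) / 8)"
    using le tp pos by (intro mult_right_mono mult_left_mono) auto
  also have "\<dots> = (node (k + 1) - t (k - 1)) * ?K / 8" unfolding 3 by simp
  also have "\<dots> = \<alpha> * ker (k + 1) (t (k - 1)) / 8"
    using kern_deriv_eq[OF alpha, of "t (k - 1)" "node (k + 1)"] st by (simp add: ker_def)
  also have "\<dots> \<le> \<alpha> * ker (k + 1) (t k) / 8"
    using ker_mono[of "t (k - 1)" "t k" "k + 1"] st alpha by simp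
  finally show ?thesis using 1 by (simp add: algebra_simps diff_divide_distrib add_divide_distrib)
qed

end

section \<open>Monotonicity of the kernels along the intervals and between time levels\<close>

context graded_mesh
begin

text \<open>The margin \<alpha>/8 is what \<open>low_ker_ge\<close> may lose, so the two bounds
  cancel exactly in \<open>pk_diff_antimono\<close>. The chord bound reduces the claim to the end
  values of the kernel, which homogeneity expresses through \<open>?G\<close> and
  \<open>R\<close>.\<close>

lemma upp_ker_le:
  assumes m: "1 \<le> m" "m + 1 \<le> N"
  shows "upp (ker (m + 1)) m \<le> (1 - \<alpha>/8) * ker m (t (m - 1))"
proof -
  define R where "R = rr t (m + 1)"
  define w where "w = 1/2 - 1 / (1 + R) / 6"
  define \<sigma> where "\<sigma> = 1 - \<alpha>/2"
  let ?g = "ker (m + 1)" and ?G = "ker m (t (m - 1))"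
  have R: "77/200 \<le> R" using ratio_ge[of "m + 1"] m by (simp add: R_def)
  have tp: "0 < tau t m" "t (m - 1) < t m" "t m < node (m + 1)" and G: "0 < ?G" and \<sigma>: "1/2 < \<sigma>" "\<sigma> \<le> 1"
    using tau_pos[of m] step_pos[of m] t_lt_node[of m "m + 1"] ker_pos[of "t (m - 1)" m] node_gt[of m] m alpha
    by (auto simp: \<sigma>_def)
  have w: "0 \<le> w" "w \<le> 1"
    using R by (auto simp: w_def field_simps)
  have "mn ?g m - 1 / (1 + R) * mo ?g m \<le> (1/2 + 1 / (1 + R) / 6) * ?g (t (m - 1)) + (1/2 - 1 / (1 + R) / 6) * ?g (t m)"
  proof -
    have "mean ?g (t (m - 1)) (t m) - 1 / (1 + R) * moment ?g (t (m - 1)) (t m)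
        \<le> (1/2 + 1 / (1 + R) / 6) * ?g (t (m - 1)) + (1/2 - 1 / (1 + R) / 6) * ?g (t m)"
      by (rule weighted_mean_le_chord[OF tp(2), where g' = "dker (m + 1)"])
        (use R tp in \<open>auto intro!: ker_deriv kern_deriv_mono[OF alpha]\<close>)
    then show ?thesis using m by (simp add: mn_def mo_def)
  qed
  then have 1: "upp ?g m \<le> w * (?g (t m) - ?g (t (m - 1)))"
    using R_def by (simp add: upp_def w_def algebra_simps diff_divide_distrib add_divide_distrib)
  have om: "omega (1 - \<alpha>) (d * x) = (1 / d) powr \<alpha> * omega (1 - \<alpha>) x" if "0 < d" "0 < x" for d x
    using that by (simp add: omega_def powr_mult powr_divide powr_minus_divide)
  have G_eq: "?G = omega (1 - \<alpha>) (\<sigma> * tau t m)" by (simp add: ker_def node_eq \<sigma>_def)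
  have ge: "node (m + 1) = t m + \<sigma> * (R * tau t m)"
    using node_eq[of "m + 1"] tau_pred[of "m + 1"] m by (simp add: \<sigma>_def R_def)
  have gb: "?g (t m) = (1 / R) powr \<alpha> * ?G"
    using om[of R "\<sigma> * tau t m"] R \<sigma> tp ge G_eq by (simp add: ker_def[of "Suc m"] mult.left_commute)
  have ga: "?g (t (m - 1)) = (\<sigma> / (1 + \<sigma> * R)) powr \<alpha> * ?G"
  proof -
    have "node (m + 1) - t (m - 1) = (1 + \<sigma> * R) / \<sigma> * (\<sigma> * tau t m)"
    proof -
      have "t m - t (m - 1) = tau t m" by (simp add: tau_def)
      then have "node (m + 1) - t (m - 1) = (1 + \<sigma> * R) * tau t m" using ge by (simp add: algebra_simps)
      then show ?thesis using \<sigma> by simp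
    qed
    then show ?thesis using om[of "(1 + \<sigma> * R) / \<sigma>" "\<sigma> * tau t m"] R \<sigma> tp G_eq
      by (simp add: ker_def[of "Suc m"] add_pos_pos)
  qed
  \<comment> \<open>Weighted arithmetic-geometric mean with second factor 1, making the upper
    estimate affine in \<alpha>.\<close>
  have young: "(1 / R) powr \<alpha> * 1 powr (1 - \<alpha>) \<le> \<alpha> * (1 / R) + (1 - \<alpha>) * 1"
    by (rule Youngs_inequality_0) (use alpha R in auto)
  \<comment> \<open>From \<sigma> > 1/2 the base is at least 1 / (2 + R); being at most 1, it only
    grows under an exponent below 1.\<close>
  have lower: "1 / (2 + R) \<le> (\<sigma> / (1 + \<sigma> * R)) powr \<alpha>"
  proof -
    have pos: "0 < 1 + \<sigma> * R" using \<sigma> R by (intro add_pos_pos mult_pos_pos) auto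
    have "1 / (2 + R) \<le> \<sigma> / (1 + \<sigma> * R)"
      using \<sigma> R pos by (simp add: field_simps)
    also have "\<dots> \<le> (\<sigma> / (1 + \<sigma> * R)) powr \<alpha>"
    proof -
      have "0 \<le> \<sigma> * R" using \<sigma> R by simp
      then have "\<sigma> / (1 + \<sigma> * R) \<le> 1" using \<sigma> pos by simp
      then have "(\<sigma> / (1 + \<sigma> * R)) powr 1 \<le> (\<sigma> / (1 + \<sigma> * R)) powr \<alpha>"
        using alpha pos \<sigma> by (intro powr_mono') auto
      then show ?thesis using pos \<sigma> by simp
    qed
    finally show ?thesis .
  qed
  have "w * ((1 / R) powr \<alpha> - (\<sigma> / (1 + \<sigma> * R)) powr \<alpha>)
      \<le> w * ((1 - \<alpha>) * (1 - 1 / (2 + R)) + \<alpha> * (1 / R - 1 / (2 + R)))"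
  proof (intro mult_left_mono)
    have "(1 - \<alpha>) * (1 - x) + \<alpha> * (y - x) = \<alpha> * y + (1 - \<alpha>) * 1 - x" for x y by (simp add: algebra_simps)
    then show "(1 / R) powr \<alpha> - (\<sigma> / (1 + \<sigma> * R)) powr \<alpha> \<le> (1 - \<alpha>) * (1 - 1 / (2 + R)) + \<alpha> * (1 / R - 1 / (2 + R))"
      using young lower by simp
  qed (use w in auto)
  also have "\<dots> = (1 - \<alpha>) * (w * (1 - 1 / (2 + R))) + \<alpha> * (w * (1 / R - 1 / (2 + R)))"
    by (simp add: algebra_simps)
  \<comment> \<open>A convex combination of the cases \<alpha> = 0 and \<alpha> = 1; the bounds 1
    and 7/8 combine to 1 - \<alpha>/8.\<close>
  also have "\<dots> \<le> (1 - \<alpha>) * 1 + \<alpha> * (7/8)"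
  proof (intro add_mono mult_left_mono)
    have "1 - 1 / (2 + R) \<le> 1" using R by simp
    then show "w * (1 - 1 / (2 + R)) \<le> 1" using w R by (intro mult_le_one) auto
    have w_eq: "w = (2 + 3 * R) / (6 * (1 + R))" using R by (simp add: w_def divide_simps) (simp add: algebra_simps)
    have R_eq: "1 / R - 1 / (2 + R) = 2 / (R * (2 + R))" using R by (simp add: divide_simps)
    have "a / (6 * b) * (2 / (R * c)) = a / (3 * (R * b * c))" for a b c
      by (simp add: divide_simps)
    then have "w * (1 / R - 1 / (2 + R)) = (2 + 3 * R) / (3 * (R * (1 + R) * (2 + R)))"
      unfolding w_eq R_eq .
    also have "\<dots> \<le> 7/8"
    proof -
      have "(77/200)^2 \<le> R^2" "(77/200)^3 \<le> R^3" using R by (intro power_mono; simp)+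
      \<comment> \<open>This is 8 (2 + 3 R) <= 21 R (1 + R) (2 + R) multiplied out.\<close>
      then have "16 \<le> 18 * R + 63 * R^2 + 21 * R^3" using R by (simp add: power2_eq_square power3_eq_cube)
      moreover have "R * (1 + R) * (2 + R) = 2 * R + 3 * R^2 + R^3" by (simp add: power2_eq_square power3_eq_cube algebra_simps)
      moreover have "0 < R * (1 + R) * (2 + R)" using R by simp
      ultimately show ?thesis by (simp add: divide_le_eq)
    qed
    finally show "w * (1 / R - 1 / (2 + R)) \<le> 7/8" .
  qed (use alpha in auto)
  finally have "w * ((1 / R) powr \<alpha> - (\<sigma> / (1 + \<sigma> * R)) powr \<alpha>) * ?G \<le> (1 - \<alpha>/8) * ?G"
    using G by (intro mult_right_mono) auto
  then show ?thesis using 1 unfolding ga gb by (simp add: algebra_simps)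
qed

lemma bk_mono:
  assumes "1 \<le> k" "k + 1 < n" "n \<le> N"
  shows "bk n k \<le> bk n (k + 1)"
proof -
  have "0 \<le> low (ker n) k + upp (ker n) (k + 1)"
    using t_lt_node[of "k + 1" n] assms
    by (intro low_upp_nonneg[where f' = "dker n"] ker_deriv kern_deriv_mono[OF alpha] kern_deriv_nonneg[OF alpha]) auto
  then show ?thesis using bk_diff[OF assms] by simp
qed

text \<open>The last increment consists of \<open>low\<close> alone, so monotonicity may fail here,
  by at most the loss in \<open>low_ker_ge\<close>.\<close>

lemma bk_top_ge:
  assumes "1 \<le> k" "k + 1 \<le> N"
  shows "bk (k + 1) k - \<alpha>/8 * ker (k + 1) (t k) \<le> bk (k + 1) (k + 1)"
proof -
  have "- (\<alpha>/8 * ker (k + 1) (t k)) \<le> low (ker (k + 1)) k"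
    using t_lt_node[of k "k + 1"] t_lt_node[of "k - 1" "k + 1"] assms
    by (intro low_ker_ge[where f' = "dker (k + 1)"] ker_deriv kern_deriv_mono[OF alpha] kern_deriv_nonneg[OF alpha]) auto
  then show ?thesis using bk_diff_top[OF assms] by simp
qed

text \<open>The first kernel is a weighted mean with nonnegative weight. This gives both its sign
  and its decrease from one level to the next.\<close>

lemma wmean_first_mono:
  assumes "1 < n" "n \<le> N" "continuous_on {t 0..t 1} f" "continuous_on {t 0..t 1} g"
    "\<And>s. s \<in> {t 0..t 1} \<Longrightarrow> f s \<le> g s"
  shows "mn f 1 - mo f 1 / (1 + rr t 2) \<le> mn g 1 - mo g 1 / (1 + rr t 2)"
  using weighted_mean_mono[of "t 0" "t 1" f g "1 / (1 + rr t 2)"] assms step_pos[of 1] rr_pos[of 2]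
  by (simp add: mn_def mo_def)

lemma bk_first: "1 < n \<Longrightarrow> n \<le> N \<Longrightarrow> bk n 1 = mn (ker n) 1 - mo (ker n) 1 / (1 + rr t 2)"
  using bk_eq[of 1 n] by (simp add: mo_def numeral_2_eq_2)

lemma bk_first_nonneg:
  assumes n: "1 < n" "n \<le> N"
  shows "0 \<le> bk n 1"
proof -
  have "mn (\<lambda>_. 0) 1 - mo (\<lambda>_. 0) 1 / (1 + rr t 2) \<le> mn (ker n) 1 - mo (ker n) 1 / (1 + rr t 2)"
    using ker_cont[of 1 n] n t_lt_node[of 1 n]
    by (intro wmean_first_mono[OF n]) (auto intro!: less_imp_le ker_pos)
  then show ?thesis using bk_first[OF n] by (simp add: mn_def mo_def mean_def moment_def)
qed

definition pk :: "nat \<Rightarrow> nat \<Rightarrow> real" where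
  "pk n k = Akern \<alpha> (\<alpha>/2) t n (n - k)"

lemma pk_eq: "k < n \<Longrightarrow> pk n k = bk n k" "pk n n = 2 * bk n n"
  by (simp_all add: pk_def Akern_def bk_def)

lemma bk_top_ge_ker:
  assumes "1 \<le> n" "n \<le> N"
  shows "ker n (t (n - 1)) \<le> bk n n"
proof (cases "n = 1")
  case True
  then show ?thesis using bk_top[OF assms] by (simp add: mo_def)
next
  case False
  then have n: "2 \<le> n" using assms by simp
  have st: "t (n - 1 - 1) < t (n - 1)" using step_pos[of "n - 1"] n assms by simp
  have "0 * (t (n - 1) - t (n - 1 - 1)) / 6 \<le> moment (ker n) (t (n - 1 - 1)) (t (n - 1))"
    using t_lt_node[of "n - 1" n] n assms
    by (intro moment_ge[OF st, where g' = "dker n"] ker_deriv kern_deriv_nonneg[OF alpha]) auto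
  then have "0 \<le> mo (ker n) (n - 1)" using n by (simp add: mo_def)
  then show ?thesis using bk_top[OF assms] rr_pos[of n] n assms by simp
qed

lemma pk_first_antimono:
  assumes n: "2 \<le> n" "n \<le> N"
  shows "pk n 1 \<le> pk (n - 1) 1"
proof (cases "n = 2")
  case True
  \<comment> \<open>Level 1 has only the doubled top kernel, at least
    \<open>2 * ker 1 (t 0)\<close>: one copy dominates \<open>upp (ker 2) 1\<close>, the other
    \<open>ker 2 (t 0)\<close>.\<close>
  have "upp (ker (1 + 1)) 1 \<le> (1 - \<alpha>/8) * ker 1 (t (1 - 1))"
    by (rule upp_ker_le) (use n True in auto)
  moreover have "ker 2 (t 0) \<le> ker 1 (t 0)"
    using ker_antimono[of "t 0" 1 2] node_mono[of 1 2] node_gt[of 1] n True by simp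
  moreover have "ker 1 (t 0) \<le> bk 1 1" using bk_top_ge_ker[of 1] n True by simp
  moreover have "0 \<le> \<alpha>/8 * ker 1 (t 0)" using ker_pos[of "t 0" 1] node_gt[of 1] n True alpha by simp
  moreover have "bk 2 1 = upp (ker 2) 1 + ker 2 (t 0)"
    using bk_first[of 2] n True by (simp add: upp_def numeral_2_eq_2)
  ultimately show ?thesis using True pk_eq(1)[of 1 2] pk_eq(2)[of 1]
    by (simp add: numeral_2_eq_2 algebra_simps)
next
  case False
  then have n3: "1 < n - 1" "n - 1 \<le> N" "1 < n" "n \<le> N" using n by auto
  have "mn (ker n) 1 - mo (ker n) 1 / (1 + rr t 2) \<le> mn (ker (n - 1)) 1 - mo (ker (n - 1)) 1 / (1 + rr t 2)"
    using ker_cont[of 1 n] ker_cont[of 1 "n - 1"] n3 t_lt_node[of 1 "n - 1"] node_mono[of "n - 1" n]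
    by (intro wmean_first_mono[OF n3(3,4)] ker_antimono) auto
  then show ?thesis unfolding pk_eq(1)[OF n3(1)] pk_eq(1)[OF n3(3)] bk_first[OF n3(1,2)] bk_first[OF n3(3,4)] .
qed

lemma low_ker_diff:
  assumes "1 \<le> k" "k < m" "m < n" "n \<le> N"
  shows "low (\<lambda>s. ker m s - ker n s) k = low (ker m) k - low (ker n) k"
proof -
  have "continuous_on {t (k - 1 - 1)..t (k - 1)} (ker j)" if "k < j" "j \<le> N" for j
    using ker_cont[of "k - 1" j] that by simp
  then show ?thesis using assms ker_cont[of k] by (intro low_diff) auto
qed

lemma upp_ker_diff:
  assumes "k < m" "m < n" "n \<le> N"
  shows "upp (\<lambda>s. ker m s - ker n s) k = upp (ker m) k - upp (ker n) k"
  using assms ker_cont[of k] by (intro upp_diff) auto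

text \<open>Below the top of level \<open>m = n - 1\<close> this is \<open>low_upp_nonneg\<close>
  for the convex increasing function \<open>?h\<close>. At the top, level \<open>m\<close> has no
  \<open>upp\<close> part; the extra \<open>bk m m\<close> from the doubling must outweigh
  \<open>upp (ker n) m\<close>.\<close>

lemma pk_diff_antimono:
  assumes k: "1 \<le> k" "k + 1 < n" "n \<le> N"
  shows "pk n (k + 1) - pk n k \<le> pk (n - 1) (k + 1) - pk (n - 1) k"
proof -
  define m where "m = n - 1"
  have m: "m < n" "k < m" "1 \<le> m" "m \<le> N" "n = m + 1" using k by (auto simp: m_def)
  let ?h = "\<lambda>s. ker m s - ker n s" and ?h' = "\<lambda>s. dker m s - dker n s"
  have nm: "node m \<le> node n" using node_mono[of m n] m k by simp
  have h: "s \<le> t j \<Longrightarrow> (?h has_real_derivative ?h' s) (at s)" "s \<le> u \<Longrightarrow> u \<le> t j \<Longrightarrow> ?h' s \<le> ?h' u"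
    "s \<le> t j \<Longrightarrow> 0 \<le> ?h' s" if "j < m" for j s u
    using t_lt_node[of j m] t_lt_node[of j n] that m k nm
    by (auto intro!: DERIV_diff ker_deriv kern_deriv_diff_mono[OF alpha] kern_deriv_antimono[OF alpha])
  have n_diff: "pk n (k + 1) - pk n k = low (ker n) k + upp (ker n) (k + 1)"
    using bk_diff[OF k] k by (simp add: pk_eq)
  have low_h: "low ?h k = low (ker m) k - low (ker n) k" using low_ker_diff[of k m n] m k by simp
  show ?thesis
  proof (cases "k + 1 < m")
    case True
    then have "pk m (k + 1) - pk m k = low (ker m) k + upp (ker m) (k + 1)"
      using bk_diff[of k m] k m by (simp add: pk_eq)
    moreover have "0 \<le> low ?h k + upp ?h (k + 1)"
      by (rule low_upp_nonneg[where f' = ?h']) (use k m True h[of "k + 1"] in auto)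
    ultimately show ?thesis
      using n_diff low_h upp_ker_diff[of "k + 1" m n] True m k unfolding m_def[symmetric] by simp
  next
    case False
    then have km: "m = k + 1" using m by simp
    have "pk m (k + 1) - pk m k = bk m m + low (ker m) k"
      using bk_diff_top[of k] k m by (simp add: pk_eq km)
    moreover have "ker m (t (m - 1)) \<le> bk m m" using bk_top_ge_ker m by simp
    moreover have "- (\<alpha>/8 * ker m (t k)) \<le> low ?h k"
      unfolding km
      by (rule low_ker_ge[where f' = ?h', unfolded km])
        (use k m h[of k] km kern_deriv_nonneg[OF alpha] in auto)
    moreover have "upp (ker n) (k + 1) \<le> (1 - \<alpha>/8) * ker m (t (m - 1))"
      using upp_ker_le[of m] m k km by simp
    ultimately show ?thesis
      using n_diff low_h km unfolding m_def[symmetric] by (simp add: algebra_simps)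
  qed
qed

end

subsection \<open>Discrete gradient structure\<close>

lemma sum_shift_zero:
  fixes f :: "nat \<Rightarrow> real"
  assumes "f 1 = 0"
  shows "(\<Sum>k = 1..m. f (k + 1)) = (\<Sum>k = 1..m + 1. f k)"
  using assms by (induction m) auto

text \<open>\<open>Gfun\<close> for an abstract kernel \<open>p\<close>: with the convention
  \<open>p 0 = 0\<close>, its separate last term is the summand \<open>j = 0\<close>.\<close>

definition quad :: "nat \<Rightarrow> (nat \<Rightarrow> real) \<Rightarrow> (nat \<Rightarrow> real) \<Rightarrow> real" where
  "quad m p w = (\<Sum>j<m. (if j = 0 then p 1 else p (j + 1) - p j) * (\<Sum>l = j + 1..m. w l)^2)"

lemma sum_by_tails:
  fixes d w :: "nat \<Rightarrow> real"
  shows "(\<Sum>k = 1..n. (\<Sum>j<k. d j) * w k) = (\<Sum>j<n. d j * (\<Sum>l = j + 1..n. w l))"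
proof (induction n)
  case (Suc n)
  have "(\<Sum>j<Suc n. d j * (\<Sum>l = j + 1..Suc n. w l)) = (\<Sum>j<Suc n. d j * (\<Sum>l = j + 1..n. w l) + d j * w (Suc n))"
    by (rule sum.cong) (auto simp: distrib_left)
  also have "\<dots> = (\<Sum>j<n. d j * (\<Sum>l = j + 1..n. w l)) + (\<Sum>j<Suc n. d j) * w (Suc n)"
    by (simp add: sum.distrib sum_distrib_right distrib_right)
  finally show ?case using Suc by simp
qed simp

text \<open>With tail sums \<open>S = T + w (m + 1)\<close>, each increment \<open>d j\<close>
  multiplies \<open>2 * w (m + 1) * S - (w (m + 1))^2 = S^2 - T^2\<close>. The right side is thus an
  exact difference for \<open>p\<close>, and passing from \<open>d\<close> to the larger
  \<open>e\<close> on the old level gives the inequality.\<close>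

lemma quad_increment_le:
  fixes p q w :: "nat \<Rightarrow> real"
  assumes first: "1 \<le> m \<Longrightarrow> p 1 \<le> q 1"
    and diff: "\<And>k. 1 \<le> k \<Longrightarrow> k < m \<Longrightarrow> p (k + 1) - p k \<le> q (k + 1) - q k"
  shows "quad (m + 1) p w - quad m q w \<le> 2 * w (m + 1) * (\<Sum>k = 1..m + 1. p k * w k) - p (m + 1) * (w (m + 1))^2"
proof -
  define d where "d j = (if j = 0 then p 1 else p (j + 1) - p j)" for j
  define e where "e j = (if j = 0 then q 1 else q (j + 1) - q j)" for j
  define S where "S j = (\<Sum>l = j + 1..m + 1. w l)" for j
  define T where "T j = (\<Sum>l = j + 1..m. w l)" for j
  let ?w = "w (m + 1)"
  have p: "(\<Sum>j<k. d j) = p k" if "1 \<le> k" for k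
    using that by (induction k rule: dec_induct) (auto simp: d_def)
  have de: "d j \<le> e j" if "j < m" for j
    using that first diff[of j] by (auto simp: d_def e_def)
  have S: "S j = T j + ?w" if "j < m + 1" for j using that by (simp add: S_def T_def)
  have "(\<Sum>k = 1..m + 1. p k * w k) = (\<Sum>k = 1..m + 1. (\<Sum>j<k. d j) * w k)"
    by (rule sum.cong) (auto simp: p)
  also have "\<dots> = (\<Sum>j<m + 1. d j * S j)" unfolding S_def by (rule sum_by_tails)
  finally have "2 * ?w * (\<Sum>k = 1..m + 1. p k * w k) - p (m + 1) * ?w^2
      = 2 * ?w * (\<Sum>j<m + 1. d j * S j) - (\<Sum>j<m + 1. d j) * ?w^2"
    using p[of "m + 1"] by simp
  also have "\<dots> = (\<Sum>j<m + 1. 2 * ?w * (d j * S j) - d j * ?w^2)"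
    by (simp only: sum_subtractf sum_distrib_left sum_distrib_right)
  also have "\<dots> = (\<Sum>j<m + 1. d j * (S j)^2 - d j * (T j)^2)"
    by (rule sum.cong) (auto simp: S power2_eq_square algebra_simps)
  also have "\<dots> = quad (m + 1) p w - (\<Sum>j<m. d j * (T j)^2)"
    by (simp add: sum_subtractf quad_def d_def S_def T_def)
  also have "\<dots> \<ge> quad (m + 1) p w - quad m q w"
    unfolding quad_def[of m q] e_def[symmetric] T_def[symmetric]
    by (intro diff_left_mono sum_mono mult_right_mono) (auto intro: de)
  finally show ?thesis .
qed

section \<open>The discrete fractional derivative: gradient inequality and one-sided bound\<close>

context graded_mesh
begin

lemma Gfun_eq_quad: "Gfun \<alpha> (\<alpha>/2) t m w = quad m (pk m) w"
proof (cases m)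
  case (Suc m')
  have "Gfun \<alpha> (\<alpha>/2) t m w = (\<Sum>j = 1..m'. (pk m (j + 1) - pk m j) * (\<Sum>l = j + 1..m. w l)^2) + pk m 1 * (\<Sum>l = 1..m. w l)^2"
    by (simp add: Gfun_def pk_def Suc)
  also have "\<dots> = (\<Sum>j<m. (if j = 0 then pk m 1 else pk m (j + 1) - pk m j) * (\<Sum>l = j + 1..m. w l)^2)"
  proof -
    have "(\<Sum>j<m. f j) = (\<Sum>j = 1..m'. f j) + f 0" for f :: "nat \<Rightarrow> real"
      unfolding Suc lessThan_Suc_atMost atMost_atLeast0 sum.atLeast_Suc_atMost[OF le0] by simp
    then show ?thesis by (auto intro!: sum.cong)
  qed
  finally show ?thesis by (simp add: quad_def)
qed (simp add: Gfun_def quad_def)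

text \<open>Each \<open>zeta\<close> term is shared between two neighbouring differences and an
  index shift collects the shares. The top kernel uses only the fraction 2 (1 - \<alpha>) / (2 -
  \<alpha>) of \<open>akern\<close> at lag 0; the rest is the diagonal surplus that drives
  dissipation.\<close>

lemma L21sigma_eq:
  assumes n: "1 \<le> n" "n \<le> N"
  shows "L21sigma \<alpha> (\<alpha>/2) t v n = (\<Sum>k = 1..n. bk n k * (v k - v (k - 1)))
    + \<alpha> / (2 - \<alpha>) * akern \<alpha> (\<alpha>/2) t n 0 * (v n - v (n - 1))"
proof -
  define w where "w k = v k - v (k - 1)" for k
  define Y where "Y k = mo (ker n) (k - 1) / (rr t k * (1 + rr t k)) * w k" for k
  define X where "X k = (mn (ker n) k - mo (ker n) k / (1 + rr t (k + 1))) * w k" for k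
  obtain m where m: "n = m + 1" using n by (metis Suc_eq_plus1 Suc_le_D One_nat_def)
  have a0: "akern \<alpha> (\<alpha>/2) t n 0 = ker n (t (n - 1)) + \<alpha> / (2 - \<alpha>) * akern \<alpha> (\<alpha>/2) t n 0"
  proof -
    have "2 * (1 - \<alpha>) / (2 - \<alpha>) + \<alpha> / (2 - \<alpha>) = 1"
      unfolding add_divide_distrib[symmetric] using alpha by simp
    then have "akern \<alpha> (\<alpha>/2) t n 0 = (2 * (1 - \<alpha>) / (2 - \<alpha>) + \<alpha> / (2 - \<alpha>)) * akern \<alpha> (\<alpha>/2) t n 0" by simp
    then show ?thesis using akern_0(2)[OF alpha step_pos[OF n]] by (simp add: ker_def distrib_right)
  qed
  have "L21sigma \<alpha> (\<alpha>/2) t v n = akern \<alpha> (\<alpha>/2) t n 0 * w n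
      + (\<Sum>k = 1..m. mn (ker n) k * w k + (w (k + 1) - rr t (k + 1) * w k) / (rr t (k + 1) * (1 + rr t (k + 1))) * mo (ker n) k)"
    unfolding L21sigma_def using n m by (auto simp: w_def akern_eq zeta_eq intro!: sum.cong)
  also have "(\<Sum>k = 1..m. mn (ker n) k * w k + (w (k + 1) - rr t (k + 1) * w k) / (rr t (k + 1) * (1 + rr t (k + 1))) * mo (ker n) k)
      = (\<Sum>k = 1..m. X k + Y (k + 1))"
  proof (rule sum.cong)
    fix k assume "k \<in> {1..m}"
    then have "0 < rr t (k + 1)" using rr_pos[of "k + 1"] n m by simp
    moreover have "(y - r * x) / (r * (1 + r)) * z = z / (r * (1 + r)) * y - z / (1 + r) * x" if "0 < r" for r x y z :: real
      using that by (simp add: diff_divide_distrib left_diff_distrib) (simp add: mult.commute)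
    ultimately show "mn (ker n) k * w k + (w (k + 1) - rr t (k + 1) * w k) / (rr t (k + 1) * (1 + rr t (k + 1))) * mo (ker n) k
        = X k + Y (k + 1)"
      unfolding X_def Y_def by (simp add: left_diff_distrib)
  qed simp
  also have "\<dots> = (\<Sum>k = 1..m. X k) + (\<Sum>k = 1..m + 1. Y k)"
    using sum_shift_zero[of Y m] by (simp add: sum.distrib Y_def mo_def)
  also have "\<dots> = (\<Sum>k = 1..m. X k + Y k) + Y n" by (simp add: sum.distrib m)
  also have "(\<Sum>k = 1..m. X k + Y k) = (\<Sum>k = 1..m. bk n k * w k)"
    using n m by (intro sum.cong) (auto simp: bk_eq X_def Y_def algebra_simps)
  finally have "L21sigma \<alpha> (\<alpha>/2) t v n = (\<Sum>k = 1..m. bk n k * w k) + Y n + akern \<alpha> (\<alpha>/2) t n 0 * w n"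
    by simp
  also have "Y n = (bk n n - ker n (t (n - 1))) * w n" using bk_top[OF n] by (simp add: Y_def)
  finally have "L21sigma \<alpha> (\<alpha>/2) t v n = (\<Sum>k = 1..m. bk n k * w k) + bk n n * w n
      + (akern \<alpha> (\<alpha>/2) t n 0 - ker n (t (n - 1))) * w n" by (simp add: algebra_simps)
  also have "akern \<alpha> (\<alpha>/2) t n 0 - ker n (t (n - 1)) = \<alpha> / (2 - \<alpha>) * akern \<alpha> (\<alpha>/2) t n 0"
    using a0 by simp
  finally show ?thesis using m by (simp add: w_def)
qed

lemma discrete_gradient:
  fixes v :: "nat \<Rightarrow> real"
  assumes n: "1 \<le> n" "n \<le> N"
  defines "w \<equiv> \<lambda>k. v k - v (k - 1)"
  shows "1/2 * (Gfun \<alpha> (\<alpha>/2) t n w - Gfun \<alpha> (\<alpha>/2) t (n - 1) w)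
     + \<alpha> / (2 - \<alpha>) * akern \<alpha> (\<alpha>/2) t n 0 * (w n)^2 \<le> w n * L21sigma \<alpha> (\<alpha>/2) t v n"
proof -
  obtain m where m: "n = m + 1" using n by (metis Suc_eq_plus1 Suc_le_D One_nat_def)
  have "quad (m + 1) (pk n) w - quad m (pk m) w \<le> 2 * w (m + 1) * (\<Sum>k = 1..m + 1. pk n k * w k) - pk n (m + 1) * (w (m + 1))^2"
    using pk_first_antimono[of n] pk_diff_antimono[of _ n] n m
    by (intro quad_increment_le) auto
  \<comment> \<open>The doubled diagonal adds one copy of \<open>bk n n * w n\<close>, which cancels
    against the subtracted \<open>pk n n * (w n)^2\<close>.\<close>
  also have "(\<Sum>k = 1..m + 1. pk n k * w k) = (\<Sum>k = 1..m + 1. bk n k * w k) + bk n n * w n"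
    using m by (auto simp: pk_eq intro!: sum.cong)
  finally have "1/2 * (quad n (pk n) w - quad m (pk m) w) \<le> w n * (\<Sum>k = 1..n. bk n k * w k)"
    using m by (simp add: pk_eq power2_eq_square algebra_simps)
  moreover define e where "e = \<alpha> / (2 - \<alpha>) * akern \<alpha> (\<alpha>/2) t n 0"
  have "L21sigma \<alpha> (\<alpha>/2) t v n = (\<Sum>k = 1..n. bk n k * w k) + e * w n"
    unfolding L21sigma_eq[OF n] w_def e_def ..
  ultimately show ?thesis
    unfolding Gfun_eq_quad e_def[symmetric] using m by (simp add: distrib_left power2_eq_square mult.left_commute)
qed

lemma L21sigma_uminus:
  "1 \<le> n \<Longrightarrow> n \<le> N \<Longrightarrow> L21sigma \<alpha> (\<alpha>/2) t (\<lambda>k. - v k) n = - L21sigma \<alpha> (\<alpha>/2) t v n"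
proof -
  have "c * (- x - - y) = - (c * (x - y))" for c x y :: real by (simp add: algebra_simps)
  then show "1 \<le> n \<Longrightarrow> n \<le> N \<Longrightarrow> ?thesis" by (simp only: L21sigma_eq sum_negf minus_add_distrib)
qed

text \<open>Summation by parts; the discarded terms \<open>- c 1 * e 0\<close> and
  \<open>(c k - c (k + 1)) * e k\<close> are nonnegative.\<close>

lemma abel_lower:
  fixes c e :: "nat \<Rightarrow> real"
  assumes "1 \<le> m" "0 \<le> c 1" "\<And>k. 1 \<le> k \<Longrightarrow> k < m \<Longrightarrow> c k \<le> c (k + 1)" "\<And>k. k < m \<Longrightarrow> e k \<le> 0"
  shows "c m * e m \<le> (\<Sum>k = 1..m. c k * (e k - e (k - 1)))"
  using assms
proof (induction m rule: dec_induct)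
  case base
  then show ?case using mult_nonneg_nonpos[of "c 1" "e 0"] by (simp add: algebra_simps)
next
  case (step m)
  have "0 \<le> (c m - c (m + 1)) * e m"
    using step.prems(2)[of m] step.prems(3)[of m] step.hyps by (intro mult_nonpos_nonpos) auto
  moreover have "c m * e m \<le> (\<Sum>k = 1..m. c k * (e k - e (k - 1)))"
    using step by simp
  ultimately show ?case by (simp add: algebra_simps)
qed

text \<open>Applied to \<open>v k - B\<close>, summation by parts collapses the history to level
  \<open>n - 1\<close>. The coefficient \<open>c1\<close> is \<open>bk n (n - 1)\<close>, or 0 for
  \<open>n = 1\<close>, where no history exists.\<close>

lemma L21sigma_lower:
  assumes n: "1 \<le> n" "n \<le> N" and v: "\<And>k. k < n \<Longrightarrow> v k \<le> B"
  defines "a \<equiv> \<alpha> / (2 - \<alpha>) * akern \<alpha> (\<alpha>/2) t n 0"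
  shows "\<exists>c1. bk n n - c1 \<ge> - (\<alpha>/8 * ker n (t (n - 1))) \<and>
    (bk n n + a) * (v n - v (n - 1)) + c1 * (v (n - 1) - B) \<le> L21sigma \<alpha> (\<alpha>/2) t v n"
proof (cases "n = 1")
  case True
  have "0 < bk 1 1" using bk_top_ge_ker[of 1] ker_pos[of "t 0" 1] node_gt[of 1] n True by simp
  moreover have "0 < ker 1 (t 0)" using ker_pos[of "t 0" 1] node_gt[of 1] n True by simp
  then have "0 \<le> \<alpha>/8 * ker 1 (t 0)" using alpha by simp
  ultimately show ?thesis using True L21sigma_eq[OF n, of v] a_def
    by (intro exI[of _ 0]) (simp add: algebra_simps)
next
  case False
  then obtain m where m: "n = m + 1" "1 \<le> m" using n by (metis Suc_eq_plus1 Suc_le_D One_nat_def Suc_leI le_neq_implies_less less_Suc_eq_le)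
  have "bk n m * (v m - B) \<le> (\<Sum>k = 1..m. bk n k * ((v k - B) - (v (k - 1) - B)))"
    by (rule abel_lower) (use m n v bk_first_nonneg[of n] bk_mono[of _ n] in auto)
  then have "(bk n n + a) * (v n - v (n - 1)) + bk n m * (v (n - 1) - B) \<le> L21sigma \<alpha> (\<alpha>/2) t v n"
    using m L21sigma_eq[OF n, of v] by (simp add: a_def algebra_simps)
  moreover have "bk n n - bk n m \<ge> - (\<alpha>/8 * ker n (t (n - 1)))"
    using bk_top_ge[of m] m n by simp
  ultimately show ?thesis by blast
qed

end

subsection \<open>The periodic grid\<close>

lemma sum_cyclic_shift:
  fixes f :: "nat \<Rightarrow> real"
  assumes "0 < M"
  shows "(\<Sum>i<M. f ((i + 1) mod M)) = (\<Sum>i<M. f i)"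
proof -
  obtain m where m: "M = Suc m" using assms gr0_implies_Suc by blast
  have "(\<Sum>i<m. f ((i + 1) mod M)) = (\<Sum>i<m. f (Suc i))"
    by (rule sum.cong) (auto simp: m)
  then show ?thesis unfolding m sum.lessThan_Suc_shift[of f] using m by simp
qed

lemma sum_cyclic_by_parts:
  fixes U V :: "nat \<Rightarrow> real"
  assumes "0 < M"
  shows "(\<Sum>i<M. V i * (U ((i + 1) mod M) + U ((i + M - 1) mod M) - 2 * U i))
       = - (\<Sum>i<M. (V ((i + 1) mod M) - V i) * (U ((i + 1) mod M) - U i))"
proof -
  have pred: "((i + 1) mod M + M - 1) mod M = i" if "i < M" for i
  proof (cases "i + 1 = M")
    case True
    then show ?thesis by auto
  next
    case False
    then have "(i + 1) mod M + M - 1 = i + M" using that by simp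
    then show ?thesis using that by simp
  qed
  have "(\<Sum>i<M. V i * U ((i + M - 1) mod M)) = (\<Sum>i<M. V ((i + 1) mod M) * U i)"
    unfolding sum_cyclic_shift[OF assms, of "\<lambda>i. V i * U ((i + M - 1) mod M)", symmetric]
    by (rule sum.cong) (use pred in auto)
  moreover have "(\<Sum>i<M. V i * U i) = (\<Sum>i<M. V ((i + 1) mod M) * U ((i + 1) mod M))"
    using sum_cyclic_shift[OF assms, of "\<lambda>i. V i * U i"] by simp
  ultimately show ?thesis
    by (simp only: mult_2 left_diff_distrib right_diff_distrib distrib_left sum.distrib sum_subtractf)
qed

lemma ip_lap_eq:
  assumes M: "0 < M" and h: "0 < h"
  shows "h^2 * (\<Sum>i<M. \<Sum>j<M. v (i, j) * lap_h M h u (i, j)) =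
    - (h^2 * (\<Sum>i<M. \<Sum>j<M. (v ((i + 1) mod M, j) - v (i, j)) / h * ((u ((i + 1) mod M, j) - u (i, j)) / h)
        + (v (i, (j + 1) mod M) - v (i, j)) / h * ((u (i, (j + 1) mod M) - u (i, j)) / h)))"
proof -
  let ?X = "\<lambda>i j. v (i, j) * (u ((i + 1) mod M, j) + u ((i + M - 1) mod M, j) - 2 * u (i, j))"
  let ?Y = "\<lambda>i j. v (i, j) * (u (i, (j + 1) mod M) + u (i, (j + M - 1) mod M) - 2 * u (i, j))"
  let ?DX = "\<lambda>i j. (v ((i + 1) mod M, j) - v (i, j)) * (u ((i + 1) mod M, j) - u (i, j))"
  let ?DY = "\<lambda>i j. (v (i, (j + 1) mod M) - v (i, j)) * (u (i, (j + 1) mod M) - u (i, j))"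
  have "h^2 * (\<Sum>i<M. \<Sum>j<M. v (i, j) * lap_h M h u (i, j)) = (\<Sum>i<M. \<Sum>j<M. ?X i j + ?Y i j)"
    unfolding sum_distrib_left by (intro sum.cong) (use h in \<open>auto simp: lap_h_def field_simps\<close>)
  also have "\<dots> = (\<Sum>j<M. \<Sum>i<M. ?X i j) + (\<Sum>i<M. \<Sum>j<M. ?Y i j)"
    by (simp only: sum.distrib) (subst sum.swap, simp)
  also have "(\<Sum>j<M. \<Sum>i<M. ?X i j) = (\<Sum>j<M. - (\<Sum>i<M. ?DX i j))"
    by (intro sum.cong sum_cyclic_by_parts[OF M]) simp
  also have "\<dots> = - (\<Sum>i<M. \<Sum>j<M. ?DX i j)" unfolding sum_negf by (subst sum.swap) simp
  also have "(\<Sum>i<M. \<Sum>j<M. ?Y i j) = (\<Sum>i<M. - (\<Sum>j<M. ?DY i j))"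
    by (intro sum.cong sum_cyclic_by_parts[OF M]) simp
  also have "- (\<Sum>i<M. \<Sum>j<M. ?DX i j) + (\<Sum>i<M. - (\<Sum>j<M. ?DY i j)) = - (\<Sum>i<M. \<Sum>j<M. ?DX i j + ?DY i j)"
    by (simp add: sum.distrib sum_negf)
  also have "(\<Sum>i<M. \<Sum>j<M. ?DX i j + ?DY i j)
      = h^2 * (\<Sum>i<M. \<Sum>j<M. (v ((i + 1) mod M, j) - v (i, j)) / h * ((u ((i + 1) mod M, j) - u (i, j)) / h)
        + (v (i, (j + 1) mod M) - v (i, j)) / h * ((u (i, (j + 1) mod M) - u (i, j)) / h))"
    unfolding sum_distrib_left by (intro sum.cong) (use h in \<open>auto simp: field_simps power2_eq_square\<close>)
  finally show ?thesis .
qed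

text \<open>After summation by parts, each difference quotient leaves the surplus (1/2 - \<theta>)
  (y - x)^2, nonnegative for \<theta> at most 1/2.\<close>

lemma grad_increment_le:
  assumes M: "0 < M" and h: "0 < h" and \<theta>: "\<theta> \<le> 1/2"
  shows "h^2 * (\<Sum>i<M. \<Sum>j<M. (b (i, j) - a (i, j)) * lap_h M h (\<lambda>x. \<theta> * a x + (1 - \<theta>) * b x) (i, j))
    \<le> - (1/2 * (gradnorm2_h M h b - gradnorm2_h M h a))"
proof -
  have ineq: "1/2 * (y^2 - x^2) \<le> (y - x) * (\<theta> * x + (1 - \<theta>) * y)" for x y :: real
  proof -
    have "(y - x) * (\<theta> * x + (1 - \<theta>) * y) - 1/2 * (y^2 - x^2) = (1/2 - \<theta>) * (y - x)^2"
      by (simp add: power2_eq_square field_simps)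
    moreover have "0 \<le> (1/2 - \<theta>) * (y - x)^2" using \<theta> by simp
    ultimately show ?thesis by linarith
  qed
  let ?D = "\<lambda>u i j. (u ((i + 1) mod M, j) - u (i, j)) / h"
  let ?E = "\<lambda>u i j. (u (i, (j + 1) mod M) - u (i, j)) / h"
  have "1/2 * (gradnorm2_h M h b - gradnorm2_h M h a)
      = h^2 * (\<Sum>i<M. \<Sum>j<M. 1/2 * ((?D b i j)^2 - (?D a i j)^2) + 1/2 * ((?E b i j)^2 - (?E a i j)^2))"
    unfolding gradnorm2_h_def
    by (simp add: sum_distrib_left[symmetric] sum.distrib sum_subtractf algebra_simps sum_divide_distrib[symmetric])
  also have "\<dots> \<le> h^2 * (\<Sum>i<M. \<Sum>j<M. (?D b i j - ?D a i j) * (\<theta> * ?D a i j + (1 - \<theta>) * ?D b i j)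
      + (?E b i j - ?E a i j) * (\<theta> * ?E a i j + (1 - \<theta>) * ?E b i j))"
    by (intro mult_left_mono sum_mono add_mono ineq) simp
  also have "\<dots> = - (h^2 * (\<Sum>i<M. \<Sum>j<M. (b (i, j) - a (i, j)) * lap_h M h (\<lambda>x. \<theta> * a x + (1 - \<theta>) * b x) (i, j)))"
  proof -
    have e: "\<theta> * (x / h) + (1 - \<theta>) * (y / h) = (\<theta> * x + (1 - \<theta>) * y) / h" for x y :: real
      by (simp add: add_divide_distrib)
    show ?thesis
      unfolding ip_lap_eq[OF M h, of "\<lambda>x. b x - a x" "\<lambda>x. \<theta> * a x + (1 - \<theta>) * b x"]
      by (simp add: algebra_simps diff_divide_distrib add_divide_distrib)
  qed
  finally show ?thesis by linarith
qed

lemma lap_h_linear: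
  "lap_h M h (\<lambda>x. \<theta> * a x + \<sigma> * b x) p = \<theta> * lap_h M h a p + \<sigma> * lap_h M h b p"
  by (cases p) (simp add: lap_h_def add_divide_distrib[symmetric] diff_divide_distrib[symmetric] algebra_simps)

lemma lap_h_uminus: "lap_h M h (\<lambda>x. - a x) p = - lap_h M h a p"
  by (cases p) (simp add: lap_h_def minus_divide_left[symmetric] diff_divide_distrib add_divide_distrib)

text \<open>With \<open>B\<close> the value at a maximum point this is the discrete maximum
  principle; with a general \<open>B\<close> it controls the explicit part of the diffusion.\<close>

lemma lap_h_le:
  assumes M: "0 < M" and ij: "i < M" "j < M" and u: "\<And>i j. i < M \<Longrightarrow> j < M \<Longrightarrow> u (i, j) \<le> B"
  shows "lap_h M h u (i, j) \<le> 4 / h^2 * (B - u (i, j))"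
proof -
  have "u ((i + 1) mod M, j) + u ((i + M - 1) mod M, j) + u (i, (j + 1) mod M) + u (i, (j + M - 1) mod M) - 4 * u (i, j)
      \<le> 4 * (B - u (i, j))"
    using u[of "(i + 1) mod M" j] u[of "(i + M - 1) mod M" j] u[of i "(j + 1) mod M"] u[of i "(j + M - 1) mod M"] M ij
    by simp
  from divide_right_mono[OF this, of "h^2"] show ?thesis by (simp add: lap_h_def)
qed

subsection \<open>The double well\<close>

lemma fAC_uminus: "fAC (- x) = - fAC x"
  by (simp add: fAC_def)

lemma fAC_strict_mono:
  assumes "1 \<le> B" "B < V"
  shows "fAC B < fAC V"
proof -
  have "B^2 \<le> V^2" "1 \<le> B^2" using assms by (auto intro: power_mono)
  moreover have "0 \<le> V * B" using assms by simp
  ultimately have "0 < V^2 + V * B + B^2 - 1" by linarith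
  then have "0 < (V - B) * (V^2 + V * B + B^2 - 1)" using assms by (intro mult_pos_pos) auto
  then show ?thesis by (simp add: fAC_def power2_eq_square power3_eq_cube algebra_simps)
qed

text \<open>The factor \<open>u + B\<close> splits off, and the quadratic cofactor has minimum 3/4
  B^2 - 1, whence the threshold 4/3.\<close>

lemma fAC_ge_neg:
  assumes B: "0 \<le> B" "4/3 \<le> B^2" and u: "- B \<le> u"
  shows "0 \<le> fAC u + fAC B"
proof -
  have "0 \<le> (u - B/2)^2 + 3/4 * B^2 - 1" using B by (simp add: add_increasing)
  then have "0 \<le> u^2 - u * B + B^2 - 1" by (simp add: power2_eq_square algebra_simps)
  then have "0 \<le> (u + B) * (u^2 - u * B + B^2 - 1)" using u by (intro mult_nonneg_nonneg) auto
  then show ?thesis by (simp add: fAC_def power2_eq_square power3_eq_cube algebra_simps)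
qed

text \<open>Convexity defect of the potential: \<open>f'\<close> ranges in \<open>[-1, 3 B\<^sup>2 - 1]\<close> on \<open>[-B, B]\<close>, and the lower
  end is charged to the implicit part, the upper end to the explicit one.\<close>

lemma FAC_increment_le:
  assumes \<theta>: "0 \<le> \<theta>" "\<theta> \<le> 1" and a: "\<bar>a\<bar> \<le> B" and b: "\<bar>b\<bar> \<le> B"
  shows "FAC b - FAC a \<le> (b - a) * (\<theta> * fAC a + (1 - \<theta>) * fAC b) + (3 * \<theta> * B^2 + 1 - 2 * \<theta>) / 2 * (b - a)^2"
proof -
  have sq: "a^2 \<le> B^2" "b^2 \<le> B^2" using a b by (simp_all add: abs_le_square_iff[symmetric])
  have "(b - a) * fAC b + 1/2 * (b - a)^2 - (FAC b - FAC a) = (b - a)^2 * (2 * b^2 + (a + b)^2) / 4"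
    by (simp add: fAC_def FAC_def power2_eq_square power3_eq_cube field_simps)
  also have "\<dots> \<ge> 0" by simp
  finally have 1: "FAC b - FAC a \<le> (b - a) * fAC b + 1/2 * (b - a)^2" by simp
  have "(b - a) * fAC a + (3 * B^2 - 1) / 2 * (b - a)^2 - (FAC b - FAC a)
      = (b - a)^2 * ((B^2 - b^2) * 2 + (B^2 - a^2) * 4 + (a - b)^2) / 4"
    by (simp add: fAC_def FAC_def power2_eq_square power3_eq_cube field_simps)
  also have "\<dots> \<ge> 0" using sq by (intro divide_nonneg_nonneg mult_nonneg_nonneg add_nonneg_nonneg) auto
  finally have 2: "FAC b - FAC a \<le> (b - a) * fAC a + (3 * B^2 - 1) / 2 * (b - a)^2" by simp
  have "FAC b - FAC a = \<theta> * (FAC b - FAC a) + (1 - \<theta>) * (FAC b - FAC a)" by (simp add: algebra_simps)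
  also have "\<dots> \<le> \<theta> * ((b - a) * fAC a + (3 * B^2 - 1) / 2 * (b - a)^2) + (1 - \<theta>) * ((b - a) * fAC b + 1/2 * (b - a)^2)"
    using \<theta> 1 2 by (intro add_mono mult_left_mono) auto
  also have "\<dots> = (b - a) * (\<theta> * fAC a + (1 - \<theta>) * fAC b) + (3 * \<theta> * B^2 + 1 - 2 * \<theta>) / 2 * (b - a)^2"
    by (simp add: field_simps)
  finally show ?thesis .
qed

text \<open>The barrier: \<open>B > 1\<close> gains \<open>f(B) > 0\<close> from the reaction term, which absorbs the possibly negative
  coefficient \<open>K\<close> of the previous time level.\<close>

lemma barrier:
  assumes \<theta>: "0 < \<theta>" "\<theta> < 1/2" and Q: "2 \<le> Q" and B: "0 \<le> B" "3 * \<theta> * B^2 = Q - 1 + 2 * \<theta>"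
    and K: "(\<theta> - 1/4) * Q \<le> K" and u: "\<bar>u\<bar> \<le> B"
  shows "0 \<le> (B - u) * K + \<theta> * fAC u + (1 - \<theta>) * fAC B"
proof -
  \<comment> \<open>As Q is at least 2, the right side is at least 1 + 2 \<theta>, hence at least 4
    \<theta>.\<close>
  have "3 * \<theta> * (4/3) \<le> 3 * \<theta> * B^2" using Q B(2) \<theta> by simp
  then have B2: "4/3 \<le> B^2" using \<theta> by (simp only: mult_le_cancel_left_pos)
  \<comment> \<open>The reaction is split as \<theta> (f(u) + f(B)) + (1 - 2 \<theta>) f(B); only
    the second part must absorb \<open>K\<close>.\<close>
  have f: "0 \<le> \<theta> * (fAC u + fAC B)"
    using fAC_ge_neg[OF B(1) B2, of u] u \<theta> by simp
  have "0 \<le> (B - u) * K + (1 - 2 * \<theta>) * fAC B"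
  proof (cases "0 \<le> K")
    case True
    have "fAC B = B * (B^2 - 1)" by (simp add: fAC_def power2_eq_square power3_eq_cube algebra_simps)
    then have "0 \<le> fAC B" using B B2 by simp
    then show ?thesis using True u \<theta> by simp
  next
    case False
    \<comment> \<open>For negative \<open>K\<close> the worst case is B - u = 2 B. After division by
      \<open>B\<close>, the factor 3 \<theta> allows \<open>Q\<close> to replace B^2.\<close>
    have "3 * \<theta> * ((1 - 2 * \<theta>) * (B^2 - 1) + 2 * ((\<theta> - 1/4) * Q)) \<ge> 0"
    proof -
      have "3 * \<theta> * ((1 - 2 * \<theta>) * (B^2 - 1) + 2 * ((\<theta> - 1/4) * Q))
          = (1 - 2 * \<theta>) * (3 * \<theta> * B^2 - 3 * \<theta>) + 3/2 * \<theta> * (4 * \<theta> - 1) * Q"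
        by (simp add: field_simps)
      also have "\<dots> = 1/2 * (Q * (14 * (\<theta> - 3/14)^2 + 5/14)) + (1 - 2 * \<theta>) * (1 + \<theta>) * (Q / 2 - 1)"
        unfolding B(2) by (simp add: power2_eq_square field_simps)
      also have "\<dots> \<ge> 0" using Q \<theta> by (intro add_nonneg_nonneg mult_nonneg_nonneg) auto
      finally show ?thesis .
    qed
    then have "0 \<le> (1 - 2 * \<theta>) * (B^2 - 1) + 2 * ((\<theta> - 1/4) * Q)"
      using \<theta> by (simp add: zero_le_mult_iff)
    then have "0 \<le> (1 - 2 * \<theta>) * (B^2 - 1) + 2 * K" using K by linarith
    then have "0 \<le> B * ((1 - 2 * \<theta>) * (B^2 - 1) + 2 * K)" using B(1) by (rule mult_nonneg_nonneg[rotated])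
    moreover have "2 * B * K \<le> (B - u) * K" using False u by (intro mult_right_mono_neg) auto
    ultimately show ?thesis by (simp add: fAC_def power2_eq_square power3_eq_cube algebra_simps)
  qed
  then show ?thesis using f by (simp add: algebra_simps)
qed

subsection \<open>A maximum bound and the energy law\<close>

definition scheme_at :: "real \<Rightarrow> (nat \<Rightarrow> real) \<Rightarrow> nat \<Rightarrow> real \<Rightarrow> real \<Rightarrow> (nat \<Rightarrow> grid_fun) \<Rightarrow> nat \<Rightarrow> bool" where
  "scheme_at \<alpha> t M h \<epsilon> \<phi> n \<longleftrightarrow> (\<forall>i<M. \<forall>j<M.
     L21sigma \<alpha> (\<alpha>/2) t (\<lambda>m. \<phi> m (i, j)) n =
       - ((\<alpha>/2) * fAC (\<phi> (n - 1) (i, j)) + (1 - \<alpha>/2) * fAC (\<phi> n (i, j))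
          - \<epsilon>^2 * lap_h M h (\<lambda>x. (\<alpha>/2) * \<phi> (n - 1) x + (1 - \<alpha>/2) * \<phi> n x) (i, j)))"

context graded_mesh
begin

lemma scheme_at_uminus:
  assumes "1 \<le> n" "n \<le> N" "scheme_at \<alpha> t M h \<epsilon> \<phi> n"
  shows "scheme_at \<alpha> t M h \<epsilon> (\<lambda>k x. - \<phi> k x) n"
  using assms(3) unfolding scheme_at_def L21sigma_uminus[OF assms(1,2)] fAC_uminus lap_h_linear lap_h_uminus
  by (simp add: algebra_simps)

text \<open>At a grid maximum V > B the implicit diffusion is nonpositive and the history is bounded
  through \<open>B\<close>. Writing V - u = (V - B) + (B - u) isolates a strictly positive term;
  \<open>barrier\<close> makes the rest nonnegative, contradicting the scheme.\<close>

lemma scheme_upper_bound: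
  assumes n: "1 \<le> n" "n \<le> N" and M: "0 < M"
    and sch: "scheme_at \<alpha> t M h \<epsilon> \<phi> n"
    and prev: "\<And>k i j. k < n \<Longrightarrow> i < M \<Longrightarrow> j < M \<Longrightarrow> \<bar>\<phi> k (i, j)\<bar> \<le> B"
    and Q: "2 \<le> Q" "Q \<le> \<alpha> / (2 - \<alpha>) * akern \<alpha> (\<alpha>/2) t n 0" "\<alpha>/2 * (4 * \<epsilon>^2 / h^2) \<le> (1 - \<alpha>/2) * Q"
    and B: "1 \<le> B" "3 * (\<alpha>/2) * B^2 = Q - 1 + \<alpha>"
    and ij: "i < M" "j < M"
  shows "\<phi> n (i, j) \<le> B"
proof (rule ccontr)
  assume "\<not> \<phi> n (i, j) \<le> B"
  define V where "V = Max (\<phi> n ` ({..<M} \<times> {..<M}))"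
  have fin: "finite (\<phi> n ` ({..<M} \<times> {..<M}))" "\<phi> n ` ({..<M} \<times> {..<M}) \<noteq> {}" using M by auto
  have le_V: "\<phi> n (i, j) \<le> V" if "i < M" "j < M" for i j
    unfolding V_def using that by (intro Max_ge[OF fin(1)]) auto
  have V: "B < V" using le_V[OF ij] \<open>\<not> \<phi> n (i, j) \<le> B\<close> by simp
  obtain k l where kl: "k < M" "l < M" "\<phi> n (k, l) = V"
    using Max_in[OF fin] unfolding V_def by auto
  define u where "u = \<phi> (n - 1) (k, l)"
  define a where "a = \<alpha> / (2 - \<alpha>) * akern \<alpha> (\<alpha>/2) t n 0"
  define S where "S = 4 * \<epsilon>^2 / h^2"
  have u: "\<bar>u\<bar> \<le> B" using prev[of "n - 1" k l] n kl by (simp add: u_def)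
  have v: "\<phi> m (k, l) \<le> B" if "m < n" for m using prev[OF that kl(1,2)] by simp
  obtain c1 where c1: "bk n n - c1 \<ge> - (\<alpha>/8 * ker n (t (n - 1)))"
    "(bk n n + a) * (V - u) + c1 * (u - B) \<le> L21sigma \<alpha> (\<alpha>/2) t (\<lambda>m. \<phi> m (k, l)) n"
    using L21sigma_lower[OF n, of "\<lambda>m. \<phi> m (k, l)" B] v unfolding a_def[symmetric] kl(3) u_def[symmetric] by blast
  \<comment> \<open>The kernel value is 2 (1 - \<alpha>) / (2 - \<alpha>) times \<open>akern\<close>
    at lag 0, so the defect is (1 - \<alpha>) a / 4: the surplus \<open>a\<close> pays for it and
    keeps 3/4 of itself.\<close>
  have "\<alpha>/8 * ker n (t (n - 1)) \<le> a / 4"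
  proof -
    have "\<alpha>/8 * ker n (t (n - 1)) = (1 - \<alpha>) * (a / 4)"
      unfolding ker_def akern_0(2)[OF alpha step_pos[OF n], symmetric] a_def
      using alpha by (simp add: field_simps)
    also have "\<dots> \<le> 1 * (a / 4)"
    proof (rule mult_right_mono)
      have "2 \<le> a" unfolding a_def using Q(1,2) by (rule order_trans)
      then show "0 \<le> a / 4" by simp
    qed (use alpha in simp)
    finally show ?thesis by simp
  qed
  from order_trans[OF le_imp_neg_le[OF this] c1(1)] have "- (a / 4) \<le> bk n n - c1" .
  moreover have "Q \<le> a" using Q(2) by (simp only: a_def)
  ultimately have c01: "3/4 * Q \<le> bk n n + a - c1" by linarith
  have b_pos: "0 < bk n n + a"
  proof -
    have "0 < bk n n" using bk_top_ge_ker[OF n] ker_pos[OF node_gt[OF n]] by simp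
    then show ?thesis using Q by (simp add: a_def)
  qed
  have lapV: "\<epsilon>^2 * lap_h M h (\<lambda>x. (\<alpha>/2) * \<phi> (n - 1) x + (1 - \<alpha>/2) * \<phi> n x) (k, l) \<le> \<alpha>/2 * S * (B - u)"
  proof -
    have "lap_h M h (\<phi> (n - 1)) (k, l) \<le> 4 / h^2 * (B - u)"
      unfolding u_def using prev[of "n - 1"] n by (intro lap_h_le[OF M kl(1,2)]) (simp add: abs_le_iff)
    moreover have "lap_h M h (\<phi> n) (k, l) \<le> 4 / h^2 * (V - V)"
      using lap_h_le[OF M kl(1,2), of "\<phi> n" V h] le_V kl(3) by simp
    ultimately have "(\<alpha>/2) * lap_h M h (\<phi> (n - 1)) (k, l) + (1 - \<alpha>/2) * lap_h M h (\<phi> n) (k, l)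
        \<le> (\<alpha>/2) * (4 / h^2 * (B - u)) + (1 - \<alpha>/2) * (4 / h^2 * (V - V))"
      using alpha by (intro add_mono mult_left_mono) auto
    then have "\<epsilon>^2 * ((\<alpha>/2) * lap_h M h (\<phi> (n - 1)) (k, l) + (1 - \<alpha>/2) * lap_h M h (\<phi> n) (k, l))
        \<le> \<epsilon>^2 * ((\<alpha>/2) * (4 / h^2 * (B - u)) + (1 - \<alpha>/2) * (4 / h^2 * (V - V)))"
      by (rule mult_left_mono) simp
    then show ?thesis unfolding lap_h_linear S_def by (simp add: algebra_simps)
  qed
  have "L21sigma \<alpha> (\<alpha>/2) t (\<lambda>m. \<phi> m (k, l)) n
      = - ((\<alpha>/2) * fAC u + (1 - \<alpha>/2) * fAC V
          - \<epsilon>^2 * lap_h M h (\<lambda>x. (\<alpha>/2) * \<phi> (n - 1) x + (1 - \<alpha>/2) * \<phi> n x) (k, l))"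
    using sch kl unfolding scheme_at_def u_def by auto
  then have "(bk n n + a) * (V - u) + c1 * (u - B) + (\<alpha>/2) * fAC u + (1 - \<alpha>/2) * fAC V \<le> \<alpha>/2 * S * (B - u)"
    using c1(2) lapV by linarith
  then have main: "(bk n n + a) * (V - B) + ((B - u) * (bk n n + a - c1 - \<alpha>/2 * S) + (\<alpha>/2) * fAC u + (1 - \<alpha>/2) * fAC V) \<le> 0"
    by (simp add: field_simps)
  have "0 \<le> (B - u) * (bk n n + a - c1 - \<alpha>/2 * S) + (\<alpha>/2) * fAC u + (1 - \<alpha>/2) * fAC B"
  proof (rule barrier[where Q = Q])
    \<comment> \<open>3/4 Q from the kernels minus at most (1 - \<alpha>/2) Q from the explicit
      diffusion.\<close>
    show "(\<alpha>/2 - 1/4) * Q \<le> bk n n + a - c1 - \<alpha>/2 * S"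
      using c01 Q(3) by (simp add: S_def algebra_simps)
  qed (use alpha Q B u in auto)
  moreover have "(1 - \<alpha>/2) * fAC B \<le> (1 - \<alpha>/2) * fAC V"
    using fAC_strict_mono[OF B(1) V] alpha by (intro mult_left_mono) auto
  moreover have "0 < (bk n n + a) * (V - B)" using b_pos V by simp
  ultimately show False using main by linarith
qed

text \<open>The scheme is tested with the increment and summed over the grid.
  \<open>discrete_gradient\<close> yields \<open>2 * e\<close> times its square; the potential
  consumes one half and the other half is the stated dissipation.\<close>

lemma energy_step:
  assumes n: "1 \<le> n" "n \<le> N" and M: "0 < M" and h: "0 < h"
    and sch: "scheme_at \<alpha> t M h \<epsilon> \<phi> n"
    and bnd: "\<And>k i j. k \<le> n \<Longrightarrow> i < M \<Longrightarrow> j < M \<Longrightarrow> \<bar>\<phi> k (i, j)\<bar> \<le> B"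
    and Q: "Q \<le> \<alpha> / (2 - \<alpha>) * akern \<alpha> (\<alpha>/2) t n 0"
    and B: "3 * (\<alpha>/2) * B^2 = Q - 1 + \<alpha>"
  shows "mod_energy \<alpha> (\<alpha>/2) t M h \<epsilon> \<phi> n - mod_energy \<alpha> (\<alpha>/2) t M h \<epsilon> \<phi> (n - 1)
    + \<alpha> / (2 * (2 - \<alpha>)) * akern \<alpha> (\<alpha>/2) t n 0
      * (h^2 * (\<Sum>i<M. \<Sum>j<M. (\<phi> n (i, j) - \<phi> (n - 1) (i, j))^2)) \<le> 0"
proof -
  let ?a = "\<phi> (n - 1)" and ?b = "\<phi> n"
  let ?G = "\<lambda>m x. Gfun \<alpha> (\<alpha>/2) t m (\<lambda>l. \<phi> l x - \<phi> (l - 1) x)"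
  define e where "e = \<alpha> / (2 * (2 - \<alpha>)) * akern \<alpha> (\<alpha>/2) t n 0"
  define lap where "lap = lap_h M h (\<lambda>x. (\<alpha>/2) * ?a x + (1 - \<alpha>/2) * ?b x)"
  have e2: "\<alpha> / (2 - \<alpha>) * akern \<alpha> (\<alpha>/2) t n 0 = 2 * e" using alpha by (simp add: e_def field_simps)
  have pointwise: "(FAC (?b x) - FAC (?a x)) + 1/2 * (?G n x - ?G (n - 1) x) + e * (?b x - ?a x)^2
      \<le> \<epsilon>^2 * ((?b x - ?a x) * lap x)" if x: "x = (i, j)" "i < M" "j < M" for x i j
  proof -
    have "FAC (?b x) - FAC (?a x) \<le> (?b x - ?a x) * (\<alpha>/2 * fAC (?a x) + (1 - \<alpha>/2) * fAC (?b x))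
        + (3 * (\<alpha>/2) * B^2 + 1 - 2 * (\<alpha>/2)) / 2 * (?b x - ?a x)^2"
      using alpha bnd[of n i j] bnd[of "n - 1" i j] x by (intro FAC_increment_le) auto
    \<comment> \<open>By the choice of \<open>B\<close> the coefficient equals Q / 2.\<close>
    moreover have "(3 * (\<alpha>/2) * B^2 + 1 - 2 * (\<alpha>/2)) / 2 * (?b x - ?a x)^2 \<le> e * (?b x - ?a x)^2"
    proof (rule mult_right_mono)
      show "(3 * (\<alpha>/2) * B^2 + 1 - 2 * (\<alpha>/2)) / 2 \<le> e" unfolding B using Q e2 by simp
    qed simp
    moreover have "1/2 * (?G n x - ?G (n - 1) x) + 2 * e * (?b x - ?a x)^2
        \<le> (?b x - ?a x) * L21sigma \<alpha> (\<alpha>/2) t (\<lambda>m. \<phi> m x) n"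
      using discrete_gradient[OF n, of "\<lambda>m. \<phi> m x"] unfolding e2 .
    moreover have "L21sigma \<alpha> (\<alpha>/2) t (\<lambda>m. \<phi> m x) n
        = \<epsilon>^2 * lap x - (\<alpha>/2 * fAC (?a x) + (1 - \<alpha>/2) * fAC (?b x))"
      using sch x unfolding scheme_at_def lap_def by auto
    ultimately show ?thesis by (simp add: right_diff_distrib mult.left_commute)
  qed
  have "h^2 * (\<Sum>i<M. \<Sum>j<M. (FAC (?b (i, j)) - FAC (?a (i, j))) + 1/2 * (?G n (i, j) - ?G (n - 1) (i, j))
        + e * (?b (i, j) - ?a (i, j))^2)
      \<le> h^2 * (\<Sum>i<M. \<Sum>j<M. \<epsilon>^2 * ((?b (i, j) - ?a (i, j)) * lap (i, j)))"
    by (intro mult_left_mono sum_mono pointwise[OF refl]) auto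
  also have "\<dots> = \<epsilon>^2 * (h^2 * (\<Sum>i<M. \<Sum>j<M. (?b (i, j) - ?a (i, j)) * lap (i, j)))"
    by (simp add: sum_distrib_left[symmetric] mult.left_commute)
  also have "\<dots> \<le> \<epsilon>^2 * (- (1/2 * (gradnorm2_h M h ?b - gradnorm2_h M h ?a)))"
    unfolding lap_def using alpha by (intro mult_left_mono grad_increment_le[OF M h]) auto
  finally have 1: "h^2 * (\<Sum>i<M. \<Sum>j<M. (FAC (?b (i, j)) - FAC (?a (i, j))) + 1/2 * (?G n (i, j) - ?G (n - 1) (i, j))
        + e * (?b (i, j) - ?a (i, j))^2) \<le> - (\<epsilon>^2 / 2 * gradnorm2_h M h ?b - \<epsilon>^2 / 2 * gradnorm2_h M h ?a)"
    by (simp add: right_diff_distrib)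
  have split: "h^2 * (\<Sum>i<M. \<Sum>j<M. (p (i, j) - q (i, j)) + 1/2 * (r (i, j) - s (i, j)) + e * z (i, j))
      = (h^2 * (\<Sum>i<M. \<Sum>j<M. p (i, j)) - h^2 * (\<Sum>i<M. \<Sum>j<M. q (i, j)))
        + 1/2 * (h^2 * (\<Sum>i<M. \<Sum>j<M. r (i, j)) - h^2 * (\<Sum>i<M. \<Sum>j<M. s (i, j)))
        + e * (h^2 * (\<Sum>i<M. \<Sum>j<M. z (i, j)))" for p q r s z :: "nat \<times> nat \<Rightarrow> real"
    by (simp only: sum.distrib sum_subtractf sum_distrib_left[symmetric] distrib_left right_diff_distrib) simp
  have rearrange: "x + p + 1/2 * r - (y + q + 1/2 * s) + z \<le> 0" if "(p - q) + 1/2 * (r - s) + z \<le> - (x - y)"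
    for p q r s x y z :: real
    using that by (simp add: field_simps)
  show ?thesis
    using 1 unfolding split[of "\<lambda>x. FAC (?b x)" "\<lambda>x. FAC (?a x)" "?G n" "?G (n - 1)" "\<lambda>x. (?b x - ?a x)^2"]
    unfolding mod_energy_def energy_def ip_h_def mult_1_right e_def[symmetric] by (rule rearrange)
qed

end

theorem theorem3p2:
  fixes \<alpha> \<epsilon> L :: real and M N :: nat
    and t :: "nat \<Rightarrow> real" and \<phi> :: "nat \<Rightarrow> nat \<times> nat \<Rightarrow> real"
  assumes alpha: "0 < \<alpha>" "\<alpha> < 1"
    and eps: "\<epsilon> > 0"
    and L: "L > 0" and M: "M > 0"
    and t0: "t 0 = 0"
    and tmono: "\<And>k. 1 \<le> k \<Longrightarrow> k \<le> N \<Longrightarrow> t (k - 1) < t k"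
    and init: "\<And>i j. i < M \<Longrightarrow> j < M \<Longrightarrow> \<bar>\<phi> 0 (i, j)\<bar> \<le> 1"
    and ratio: "\<And>k. 2 \<le> k \<Longrightarrow> k \<le> N \<Longrightarrow> rr t k \<ge> r_star \<alpha>"
    and step: "\<And>n. 1 \<le> n \<Longrightarrow> n \<le> N \<Longrightarrow>
       tau t n \<le> min (((\<alpha>/2) * omega (2 - \<alpha>) (1 - \<alpha>/2) / (2 * (1 - \<alpha>/2))) powr (1/\<alpha>))
                     (((L / real M)^2 * omega (2 - \<alpha>) (1 - \<alpha>/2) / (4 * \<epsilon>^2)) powr (1/\<alpha>))"
    and scheme: "\<And>n i j. 1 \<le> n \<Longrightarrow> n \<le> N \<Longrightarrow> i < M \<Longrightarrow> j < M \<Longrightarrow>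
       L21sigma \<alpha> (\<alpha>/2) t (\<lambda>m. \<phi> m (i, j)) n =
         - ((\<alpha>/2) * fAC (\<phi> (n - 1) (i, j)) + (1 - \<alpha>/2) * fAC (\<phi> n (i, j))
            - \<epsilon>^2 * lap_h M (L / real M)
                (\<lambda>x. (\<alpha>/2) * \<phi> (n - 1) x + (1 - \<alpha>/2) * \<phi> n x) (i, j))"
  shows "\<forall>n. 1 \<le> n \<and> n \<le> N \<longrightarrow>
     (mod_energy \<alpha> (\<alpha>/2) t M (L / real M) \<epsilon> \<phi> n
        - mod_energy \<alpha> (\<alpha>/2) t M (L / real M) \<epsilon> \<phi> (n - 1)) / tau t n
     + \<alpha> / (2 * (2 - \<alpha>)) * akern \<alpha> (\<alpha>/2) t n 0 * tau t n
       * ip_h M (L / real M) (\<lambda>x. (\<phi> n x - \<phi> (n - 1) x) / tau t n)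
                             (\<lambda>x. (\<phi> n x - \<phi> (n - 1) x) / tau t n) \<le> 0"
proof -
  interpret graded_mesh \<alpha> t N
    using alpha tmono ratio order_trans[OF r_star_ge[OF alpha]] by unfold_locales auto
  define h where "h = L / real M"
  have h: "0 < h" using L M by (simp add: h_def)
  define S where "S = 4 * \<epsilon>^2 / h^2"
  have S: "0 < S" using eps h by (simp add: S_def)
  \<comment> \<open>The two entries are the lower bounds on the surplus coefficient that the two
    step restrictions provide.\<close>
  define Q where "Q = max 2 (\<alpha> / (2 - \<alpha>) * S)"
  define B where "B = sqrt ((Q - 1 + \<alpha>) / (3 * (\<alpha>/2)))"
  have Q2: "2 \<le> Q" and QS: "\<alpha>/2 * S \<le> (1 - \<alpha>/2) * Q"
  proof -
    show "2 \<le> Q" by (simp add: Q_def)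
    have "(1 - \<alpha>/2) * (\<alpha> / (2 - \<alpha>) * S) \<le> (1 - \<alpha>/2) * Q"
      using alpha by (intro mult_left_mono) (auto simp: Q_def)
    moreover have "(1 - \<alpha>/2) * (\<alpha> / (2 - \<alpha>) * S) = \<alpha>/2 * S"
    proof -
      have "1 - \<alpha>/2 = (2 - \<alpha>) / 2" by (simp add: field_simps)
      then show ?thesis using alpha by (simp only:) (simp add: field_simps)
    qed
    ultimately show "\<alpha>/2 * S \<le> (1 - \<alpha>/2) * Q" by (simp only:)
  qed
  have Qa: "Q \<le> \<alpha> / (2 - \<alpha>) * akern \<alpha> (\<alpha>/2) t n 0" if n: "1 \<le> n" "n \<le> N" for n
  proof -
    have "1 \<le> \<alpha> / (2 - \<alpha>) / 2 * akern \<alpha> (\<alpha>/2) t n 0"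
    proof (rule akern_0_ge[where c = "\<alpha> / (2 - \<alpha>) / 2", OF alpha step_pos[OF n]])
      have "(\<alpha>/2) * omega (2 - \<alpha>) (1 - \<alpha>/2) / (2 * (1 - \<alpha>/2)) = \<alpha> / (2 - \<alpha>) / 2 * omega (2 - \<alpha>) (1 - \<alpha>/2)"
        using alpha by (simp add: field_simps)
      then show "tau t n \<le> (\<alpha> / (2 - \<alpha>) / 2 * omega (2 - \<alpha>) (1 - \<alpha>/2)) powr (1/\<alpha>)"
        using order_trans[OF step[OF n] min.cobounded1] by (simp only:)
    qed (use alpha in simp)
    moreover have "1 \<le> 1 / S * akern \<alpha> (\<alpha>/2) t n 0"
    proof (rule akern_0_ge[OF alpha step_pos[OF n]])
      have "h^2 * omega (2 - \<alpha>) (1 - \<alpha>/2) / (4 * \<epsilon>^2) = 1 / S * omega (2 - \<alpha>) (1 - \<alpha>/2)"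
        by (simp add: S_def)
      then show "tau t n \<le> (1 / S * omega (2 - \<alpha>) (1 - \<alpha>/2)) powr (1/\<alpha>)"
        using step[OF n] unfolding h_def[symmetric] by simp
    qed (use S in simp)
    then have "\<alpha> / (2 - \<alpha>) * S \<le> \<alpha> / (2 - \<alpha>) * akern \<alpha> (\<alpha>/2) t n 0"
      using alpha S by (intro mult_left_mono) (auto simp: field_simps)
    moreover have "2 \<le> c * x" if "1 \<le> c / 2 * x" for c x :: real using that by simp
    ultimately show ?thesis unfolding Q_def by (intro max.boundedI)
  qed
  \<comment> \<open>Gives B >= 1, so the initial data satisfy the invariant.\<close>
  have quot: "1 \<le> (Q - 1 + \<alpha>) / (3 * (\<alpha>/2))" using Q2 alpha by simp
  then have B: "1 \<le> B" "3 * (\<alpha>/2) * B^2 = Q - 1 + \<alpha>"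
    using alpha Q2 by (simp_all add: B_def)
  have sch: "scheme_at \<alpha> t M h \<epsilon> \<phi> n" if "1 \<le> n" "n \<le> N" for n
    using scheme[OF that] by (simp add: scheme_at_def h_def)
  have bnd: "\<bar>\<phi> n (i, j)\<bar> \<le> B" if "n \<le> N" "i < M" "j < M" for n i j
    using that
  proof (induction n arbitrary: i j rule: less_induct)
    case (less n)
    show ?case
    proof (cases "n = 0")
      case True
      then show ?thesis using init[of i j] less.prems B by simp
    next
      case False
      then have n: "1 \<le> n" "n \<le> N" using less.prems by auto
      have "\<phi> n (i, j) \<le> B"
        by (rule scheme_upper_bound[OF n M sch[OF n] _ Q2 Qa[OF n] QS[unfolded S_def] B])
          (use less n in auto)
      moreover have "- \<phi> n (i, j) \<le> B"
        \<comment> \<open>Every term of the scheme is odd, so the upper bound for the negated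
          solution is the lower bound.\<close>
        by (rule scheme_upper_bound[OF n M scheme_at_uminus[OF n sch[OF n]] _ Q2 Qa[OF n] QS[unfolded S_def] B])
          (use less n in auto)
      ultimately show ?thesis by simp
    qed
  qed
  show ?thesis
  proof (intro allI impI; elim conjE)
    fix n assume n: "1 \<le> n" "n \<le> N"
    let ?D = "mod_energy \<alpha> (\<alpha>/2) t M h \<epsilon> \<phi> n - mod_energy \<alpha> (\<alpha>/2) t M h \<epsilon> \<phi> (n - 1)"
    let ?e = "\<alpha> / (2 * (2 - \<alpha>)) * akern \<alpha> (\<alpha>/2) t n 0"
    let ?W = "h^2 * (\<Sum>i<M. \<Sum>j<M. (\<phi> n (i, j) - \<phi> (n - 1) (i, j))^2)"
    have tp: "0 < tau t n" by (rule tau_pos[OF n])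
    have "?D + ?e * ?W \<le> 0"
      by (rule energy_step[OF n M h sch[OF n] _ Qa[OF n] B(2)]) (use bnd n in auto)
    then have "(?D + ?e * ?W) / tau t n \<le> 0" using tp by (simp add: divide_nonpos_pos)
    moreover have "tau t n * ip_h M h (\<lambda>x. (\<phi> n x - \<phi> (n - 1) x) / tau t n) (\<lambda>x. (\<phi> n x - \<phi> (n - 1) x) / tau t n)
        = ?W / tau t n"
    proof -
      have "ip_h M h (\<lambda>x. (\<phi> n x - \<phi> (n - 1) x) / tau t n) (\<lambda>x. (\<phi> n x - \<phi> (n - 1) x) / tau t n)
          = ?W / (tau t n)^2"
        by (simp add: ip_h_def power2_eq_square sum_divide_distrib[symmetric])
      then show ?thesis using tp by (simp add: power2_eq_square)
    qed
    ultimately show "(mod_energy \<alpha> (\<alpha>/2) t M (L / real M) \<epsilon> \<phi> n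
        - mod_energy \<alpha> (\<alpha>/2) t M (L / real M) \<epsilon> \<phi> (n - 1)) / tau t n
     + \<alpha> / (2 * (2 - \<alpha>)) * akern \<alpha> (\<alpha>/2) t n 0 * tau t n
       * ip_h M (L / real M) (\<lambda>x. (\<phi> n x - \<phi> (n - 1) x) / tau t n)
                             (\<lambda>x. (\<phi> n x - \<phi> (n - 1) x) / tau t n) \<le> 0"
      unfolding h_def[symmetric] mult.assoc[of ?e] by (simp add: add_divide_distrib)
  qed
qed

end
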